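(* Let $\alpha,\beta,\gamma,\rho,\lambda,\omega\in\mathbb{R}$ with $\alpha>0$, $\beta>0$, $\beta\notin\mathbb{N}$, $\rho>0$, put $n=[\beta]+1$, let $b_0,\dots,b_{n-1}\in\mathbb{R}$, and let $f\in C[a,b]$. The solution $u\in C^{n-1}[a,b]$ of the Volterra integral equation $$ u(x)=\sum_{i=0}^{n-1}b_i\frac{(\psi(x)-\psi(a))^{i}}{i!} +\lambda\int_{a}^{x}\psi'(t)(\psi(x)-\psi(t))^{\alpha+\beta-1}E_{\rho,\alpha+\beta}^{\gamma}[\omega(\psi(x)-\psi(t))^{\rho}]\,u(t)\,{\rm d}t +\frac{1}{\Gamma(\beta)}\int_{a}^{x}\psi'(t)(\psi(x)-\psi(t))^{\beta-1}f(t)\,{\rm d}t,\quad x\in[a,b], $$ is given by $$ u(x)=\sum_{i=0}^{n-1}b_i(\psi(x)-\psi(a))^{i}\sum_{j=0}^{\infty}\lambda^{j}(\psi(x)-\psi(a))^{j(\alpha+\beta)}E_{\rho,j(\alpha+\beta)+i+1}^{j\gamma}[\omega(\psi(x)-\psi(a))^{\rho}] +\sum_{j=0}^{\infty}\lambda^j\,\mathbb{E}_{\rho,j(\alpha+\beta)+\beta,\omega;a+}^{j\gamma;\psi}f(x). $$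
   Context: Let $[a,b]$ be a finite interval, $0<a<b<\infty$, and let $\psi\in C^n[a,b]$ be increasing with $\psi'(x)\neq 0$ for all $x\in[a,b]$. $C^{m}[a,b]$ is the space of $m$ times continuously differentiable real functions on $[a,b]$. Three-parameter Mittag-Leffler function: for real $\alpha,\gamma,\rho,z$ with $\rho>0$, $E_{\rho,\alpha}^{\gamma}(z)=\sum_{k=0}^{\infty}\frac{(\gamma)_k}{\Gamma(\rho k+\alpha)}\frac{z^k}{k!}$, where $(\gamma)_0=1$, $(\gamma)_k=\gamma(\gamma+1)\cdots(\gamma+k-1)$ for $k\ge 1$. For $\alpha,\rho>0$ and $\gamma,\omega\in\mathbb{R}$: $\mathbb{E}_{\rho,\alpha,\omega;a+}^{\gamma;\psi}f(x)=\int_{a}^{x}\psi'(t)(\psi(x)-\psi(t))^{\alpha-1}E_{\rho,\alpha}^{\gamma}[\omega(\psi(x)-\psi(t))^{\rho}]f(t)\,{\rm d}t$. In particular, for $\gamma=0$ this is $\frac{1}{\Gamma(\alpha)}\int_a^x\psi'(t)(\psi(x)-\psi(t))^{\alpha-1}f(t)\,{\rm d}t$. *)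

theory Defs
  imports "HOL-Analysis.Analysis"
begin

text \<open>
  The derivative of a real function on \<open>[a,b]\<close>. It is taken within the interval, hence one-sided
  at the two endpoints: nothing is assumed about the function outside \<open>[a,b]\<close>.
\<close>

definition deriv_Icc :: "real \<Rightarrow> real \<Rightarrow> (real \<Rightarrow> real) \<Rightarrow> real \<Rightarrow> real" where
  "deriv_Icc a b f x = vector_derivative f (at x within {a..b})"

definition C_Icc :: "nat \<Rightarrow> real \<Rightarrow> real \<Rightarrow> (real \<Rightarrow> real) \<Rightarrow> bool" where
  "C_Icc m a b f \<longleftrightarrow>
     (\<forall>k<m. ((deriv_Icc a b ^^ k) f) differentiable_on {a..b}) \<and>
     continuous_on {a..b} ((deriv_Icc a b ^^ m) f)"

text \<open>
  Real powers with \<open>0\<close> to the power \<open>0\<close> equal to \<open>1\<close>; the library has \<open>0 powr 0 = 0\<close>. This matters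
  for the terms \<open>(\<psi> x - \<psi> a)\<close> to the power \<open>j (\<alpha> + \<beta>)\<close> with \<open>j = 0\<close> and \<open>x = a\<close>.
\<close>

definition rpow :: "real \<Rightarrow> real \<Rightarrow> real" where
  "rpow x p = (if p = 0 then 1 else x powr p)"

text \<open>
  The three-parameter Mittag-Leffler function, for \<open>\<rho> > 0\<close>. At the poles of Gamma (possible only
  if \<open>\<alpha> \<le> 0\<close>) the usual convention \<open>1 / Gamma = 0\<close> is what the library's \<open>Gamma = 0\<close> and
  \<open>x / 0 = 0\<close> give.
\<close>

definition mittag_leffler :: "real \<Rightarrow> real \<Rightarrow> real \<Rightarrow> real \<Rightarrow> real" where
  "mittag_leffler \<gamma> \<rho> \<alpha> z =
     (\<Sum>k. pochhammer \<gamma> k / Gamma (\<rho> * real k + \<alpha>) * (z ^ k / fact k))"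

text \<open>
  The operator with kernel parameters \<open>\<gamma>\<close> (upper index) and \<open>\<rho>, \<alpha>, \<omega>\<close> (lower indices), acting on
  functions on \<open>[a,b]\<close>. The value of the kernel at the single point \<open>t = x\<close> is irrelevant.
\<close>

definition prabhakar_int ::
  "real \<Rightarrow> real \<Rightarrow> (real \<Rightarrow> real) \<Rightarrow> real \<Rightarrow> real \<Rightarrow> real \<Rightarrow> real \<Rightarrow> (real \<Rightarrow> real) \<Rightarrow> real \<Rightarrow> real" where
  "prabhakar_int a b \<psi> \<gamma> \<rho> \<alpha> \<omega> f x =
     integral {a..x} (\<lambda>t. deriv_Icc a b \<psi> t * rpow (\<psi> x - \<psi> t) (\<alpha> - 1)
       * mittag_leffler \<gamma> \<rho> \<alpha> (\<omega> * rpow (\<psi> x - \<psi> t) \<rho>) * f t)"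

end

theory Submission
  imports Defs
begin

text \<open>
  The substitution \<open>s = \<psi> t - \<psi> a\<close> transforms the equation into \<open>v = g + \<lambda> K v\<close> on \<open>[0,T]\<close>, where \<open>K\<close> is the
  convolution with the kernel \<open>s powr (\<alpha> + \<beta> - 1) * E (\<omega> s powr \<rho>)\<close> and \<open>g\<close> consists of monomials
  \<open>x ^ i / fact i\<close> and the Riemann-Liouville integral of order \<open>\<beta>\<close> of the source. The solution is the Neumann series
  \<open>\<Sum>j. \<lambda> ^ j * (K ^ j) g\<close>, and the claimed formula is this series with the iterates in closed form.

  Convergence and uniqueness hold for every absolutely integrable kernel. Conjugation with \<open>exp (M x)\<close>
  multiplies the kernel by \<open>exp (- M s)\<close>, and its integral becomes arbitrarily small as \<open>M\<close> grows. So
  \<open>\<lambda> K\<close> is a contraction in an exponentially weighted supremum norm (\<open>volterra_contraction\<close>,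
  \<open>neumann_series\<close>, \<open>volterra_homogeneous_unique\<close>).

  The iterates are found from the semigroup law \<open>prabhakar_semigroup\<close>: the operators with a three-parameter
  Mittag-Leffler kernel, the Prabhakar integrals, compose by adding the parameters \<open>\<gamma>\<close> and \<open>\<alpha>\<close>. Indeed such an operator is
  \<open>\<Sum>k. pochhammer \<gamma> k / fact k * \<omega> ^ k * I (\<rho> k + \<alpha>)\<close> with \<open>I p\<close> the Riemann-Liouville integral of order \<open>p\<close>
  (\<open>prabhakar_sums\<close>). Since \<open>I p (I q u) = I (p + q) u\<close> (\<open>RL_semigroup\<close>), the law is the Chu-Vandermonde identity for the
  coefficients. Hence \<open>K ^ j\<close> applied to the Riemann-Liouville integral of order \<open>\<beta>\<close> is the operator with parameters
  \<open>j \<gamma>\<close> and \<open>j (\<alpha> + \<beta>) + \<beta>\<close>. The images of monomials follow from the Beta integral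
  (\<open>prabhakar_monomial\<close>).

  For the existence of a solution in \<open>C^{n-1}\<close>, the sum of the Neumann series is first only continuous. Differentiating a
  Prabhakar integral of order \<open>p > 1\<close> gives the one of order \<open>p - 1\<close> (\<open>prabhakar_has_derivative\<close>), and both
  integrals in the equation have an order larger than \<open>n - 1\<close>, so the equation itself shows that the sum is
  \<open>n - 1\<close> times continuously differentiable.
\<close>

section \<open>Volterra convolution operators\<close>

text \<open>
  On \<open>[0,x]\<close> this is the convolution of the two functions. All integral operators below are of this
  form, with kernels that are merely absolutely integrable because they may blow up at \<open>0\<close>.
\<close>

definition volterra :: "(real \<Rightarrow> real) \<Rightarrow> (real \<Rightarrow> real) \<Rightarrow> real \<Rightarrow> real" where
  "volterra k u x = integral {0..x} (\<lambda>t. k (x - t) * u t)"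

lemma absolutely_integrable_times_continuous:
  fixes h u :: "real \<Rightarrow> real"
  assumes "h absolutely_integrable_on {c..d}" "continuous_on {c..d} u"
  shows "(\<lambda>t. h t * u t) absolutely_integrable_on {c..d}"
proof -
  have "(\<lambda>t. u t * h t) absolutely_integrable_on {c..d}"
  proof (rule absolutely_integrable_bounded_measurable_product_real[OF _ _ _ assms(1)])
    show "u \<in> borel_measurable (lebesgue_on {c..d})"
      using assms(2) by (intro continuous_imp_measurable_on_sets_lebesgue) auto
    show "bounded (u ` {c..d})"
      using assms(2) by (intro compact_imp_bounded compact_continuous_image) auto
  qed auto
  then show ?thesis by (simp add: mult.commute)
qed

lemma integral_nonneg_Icc:
  fixes h :: "real \<Rightarrow> real"
  assumes "\<And>t. t \<in> S \<Longrightarrow> 0 \<le> h t"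
  shows "0 \<le> integral S h"
  using assms by (cases "h integrable_on S") (auto intro: integral_nonneg simp: not_integrable_integral)

lemma reflect_Icc:
  fixes h :: "real \<Rightarrow> real"
  shows "(\<lambda>t. h (x - t)) absolutely_integrable_on {0..x} \<longleftrightarrow> h absolutely_integrable_on {0..x}"
    and "h absolutely_integrable_on {0..x} \<Longrightarrow> integral {0..x} (\<lambda>t. h (x - t)) = integral {0..x} h"
proof -
  have img: "(\<lambda>t. x - t) ` {0..x} = {0..x}"
    by (auto simp: image_iff intro!: bexI[of _ "x - _"])
  have *: "(\<lambda>t. \<bar>- 1\<bar> * h (x - t)) absolutely_integrable_on {0..x} \<and>
           integral {0..x} (\<lambda>t. \<bar>- 1\<bar> * h (x - t)) = b
     \<longleftrightarrow> h absolutely_integrable_on ((\<lambda>t. x - t) ` {0..x}) \<and> integral ((\<lambda>t. x - t) ` {0..x}) h = b" for b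
    by (rule has_absolute_integral_change_of_variables_1')
       (auto intro!: derivative_eq_intros inj_onI)
  show "(\<lambda>t. h (x - t)) absolutely_integrable_on {0..x} \<longleftrightarrow> h absolutely_integrable_on {0..x}"
    using * unfolding img by auto
  show "integral {0..x} (\<lambda>t. h (x - t)) = integral {0..x} h"
    if "h absolutely_integrable_on {0..x}"
    using * that unfolding img by auto
qed

lemma absolutely_integrable_on_initial:
  fixes k :: "real \<Rightarrow> real"
  assumes "k absolutely_integrable_on {0..T}" "x \<le> T"
  shows "k absolutely_integrable_on {0..x}"
  using assms by (meson absolutely_integrable_on_subinterval atLeastatMost_subset_iff order_refl)

context
  fixes k :: "real \<Rightarrow> real" and x :: real
  assumes k: "k absolutely_integrable_on {0..x}"
begin

lemma volterra_integrable:
  assumes "continuous_on {0..x} u"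
  shows "(\<lambda>t. k (x - t) * u t) absolutely_integrable_on {0..x}"
  using k assms by (intro absolutely_integrable_times_continuous) (simp_all add: reflect_Icc)

lemma volterra_integrable_on: 
  assumes "continuous_on {0..x} u"
  shows "(\<lambda>t. k (x - t) * u t) integrable_on {0..x}"
  using volterra_integrable[OF assms] set_lebesgue_integral_eq_integral(1) by blast

lemma volterra_add:
  assumes "continuous_on {0..x} u" "continuous_on {0..x} v"
  shows "volterra k (\<lambda>t. u t + v t) x = volterra k u x + volterra k v x"
  unfolding volterra_def distrib_left
  by (intro integral_add volterra_integrable_on assms)

lemma volterra_diff:
  assumes "continuous_on {0..x} u" "continuous_on {0..x} v"
  shows "volterra k (\<lambda>t. u t - v t) x = volterra k u x - volterra k v x"
  unfolding volterra_def right_diff_distrib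
  by (intro integral_diff volterra_integrable_on assms)

lemma volterra_scale: "volterra k (\<lambda>t. r * u t) x = r * volterra k u x"
  unfolding volterra_def by (simp add: mult.left_commute)

lemma volterra_sum:
  assumes "finite I" "\<And>i. i \<in> I \<Longrightarrow> continuous_on {0..x} (u i)"
  shows "volterra k (\<lambda>t. \<Sum>i\<in>I. u i t) x = (\<Sum>i\<in>I. volterra k (u i) x)"
  unfolding volterra_def sum_distrib_left
  by (intro integral_sum volterra_integrable_on assms)

text \<open>
  The weight \<open>exp (M t)\<close> factors through the convolution: it turns the kernel \<open>k s\<close> into
  \<open>k s * exp (- M s)\<close>. For large \<open>M\<close> the latter has a small integral, and \<open>M = 0\<close> is the
  ordinary bound by the supremum.
\<close>

lemma volterra_bound_exp:
  assumes u: "continuous_on {0..x} u" and le: "\<And>t. t \<in> {0..x} \<Longrightarrow> \<bar>u t\<bar> \<le> B * exp (M * t)"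
  shows "\<bar>volterra k u x\<bar> \<le> integral {0..x} (\<lambda>s. \<bar>k s\<bar> * exp (- M * s)) * (B * exp (M * x))"
proof -
  let ?h = "\<lambda>s. \<bar>k s\<bar> * exp (- M * s)"
  have h: "?h absolutely_integrable_on {0..x}"
    using absolutely_integrable_norm[OF k]
    by (intro absolutely_integrable_times_continuous continuous_intros) (simp add: o_def)
  have "norm (integral {0..x} (\<lambda>t. k (x - t) * u t))
      \<le> integral {0..x} (\<lambda>t. ?h (x - t) * (B * exp (M * x)))"
  proof (rule integral_norm_bound_integral)
    show "(\<lambda>t. k (x - t) * u t) integrable_on {0..x}"
      by (rule volterra_integrable_on[OF u])
    have "(\<lambda>t. ?h (x - t)) absolutely_integrable_on {0..x}"
      by (rule iffD2[OF reflect_Icc(1) h])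
    then have "(\<lambda>t. ?h (x - t)) integrable_on {0..x}"
      using set_lebesgue_integral_eq_integral(1) by blast
    then show "(\<lambda>t. ?h (x - t) * (B * exp (M * x))) integrable_on {0..x}"
      by (rule integrable_on_mult_left)
    fix t assume t: "t \<in> {0..x}"
    have "norm (k (x - t) * u t) \<le> \<bar>k (x - t)\<bar> * (B * exp (M * t))"
      using le[OF t] by (simp add: abs_mult mult_left_mono)
    also have "\<dots> = ?h (x - t) * (B * exp (M * x))"
      by (simp add: algebra_simps flip: exp_add)
    finally show "norm (k (x - t) * u t) \<le> ?h (x - t) * (B * exp (M * x))" .
  qed
  also have "\<dots> = integral {0..x} (\<lambda>t. ?h (x - t)) * (B * exp (M * x))"
    by (rule integral_mult_left)
  also have "integral {0..x} (\<lambda>t. ?h (x - t)) = integral {0..x} ?h"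
    by (rule reflect_Icc(2)[OF h])
  finally show ?thesis by (simp add: volterra_def)
qed

lemma volterra_bound:
  assumes "continuous_on {0..x} u" "\<And>t. t \<in> {0..x} \<Longrightarrow> \<bar>u t\<bar> \<le> B"
  shows "\<bar>volterra k u x\<bar> \<le> integral {0..x} (\<lambda>s. \<bar>k s\<bar>) * B"
  using volterra_bound_exp[of u B 0] assms by simp

text \<open>
  An operator that is bounded in the supremum norm commutes with uniformly convergent series.
\<close>

lemma volterra_sums:
  assumes u: "\<And>j. continuous_on {0..x} (u j)" and m: "summable m"
    and le: "\<And>j t. t \<in> {0..x} \<Longrightarrow> \<bar>u j t\<bar> \<le> m j"
  shows "(\<lambda>j. volterra k (u j) x) sums volterra k (\<lambda>t. \<Sum>j. u j t) x"
    and "continuous_on {0..x} (\<lambda>t. \<Sum>j. u j t)"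
proof -
  have unif: "uniform_limit {0..x} (\<lambda>N t. \<Sum>j<N. u j t) (\<lambda>t. \<Sum>j. u j t) sequentially"
    by (rule Weierstrass_m_test) (use m le in auto)
  show cont: "continuous_on {0..x} (\<lambda>t. \<Sum>j. u j t)"
    by (rule uniform_limit_theorem[OF _ unif]) (auto intro!: always_eventually continuous_on_sum u)
  show "(\<lambda>j. volterra k (u j) x) sums volterra k (\<lambda>t. \<Sum>j. u j t) x"
    unfolding sums_def tendsto_iff dist_real_def
  proof (intro allI impI)
    fix e :: real assume e: "e > 0"
    let ?I = "integral {0..x} (\<lambda>s. \<bar>k s\<bar>)"
    have I: "?I \<ge> 0" by (intro integral_nonneg_Icc) auto
    have "eventually (\<lambda>N. \<forall>t\<in>{0..x}. dist (\<Sum>j<N. u j t) (\<Sum>j. u j t) < e / (?I + 1)) sequentially"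
      using unif e I by (auto simp: uniform_limit_iff)
    then show "eventually (\<lambda>N. \<bar>(\<Sum>j<N. volterra k (u j) x) - volterra k (\<lambda>t. \<Sum>j. u j t) x\<bar> < e)
        sequentially"
    proof eventually_elim
      case (elim N)
      have "(\<Sum>j<N. volterra k (u j) x) - volterra k (\<lambda>t. \<Sum>j. u j t) x
          = volterra k (\<lambda>t. (\<Sum>j<N. u j t) - (\<Sum>j. u j t)) x"
        by (simp add: volterra_diff volterra_sum u cont continuous_on_sum)
      also have "\<bar>\<dots>\<bar> \<le> ?I * (e / (?I + 1))"
        using elim by (intro volterra_bound continuous_intros u cont) (auto simp: dist_real_def intro: less_imp_le)
      also have "\<dots> < e" using e I by (simp add: field_simps)
      finally show ?case .
    qed
  qed
qed

end

lemma volterra_cong: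
  assumes "\<And>t. t \<in> {0..x} \<Longrightarrow> u t = v t"
  shows "volterra k u x = volterra k v x"
  unfolding volterra_def using assms by (intro integral_cong) auto

text \<open>
  The point \<open>0\<close> is excluded to identify \<open>t ^ 0 = 1\<close> with \<open>t powr 0\<close>, which vanishes there.
\<close>

lemma volterra_cong_Ioc:
  assumes "\<And>t. 0 < t \<Longrightarrow> t \<le> x \<Longrightarrow> u t = v t"
  shows "volterra k u x = volterra k v x"
  unfolding volterra_def using assms by (intro integral_spike[of "{0}"]) auto

lemma volterra_reflect:
  assumes "k absolutely_integrable_on {0..x}" "continuous_on {0..x} u"
  shows "volterra k u x = integral {0..x} (\<lambda>s. k s * u (x - s))"
proof -
  have "continuous_on {0..x} (\<lambda>s. u (x - s))"
    by (rule continuous_on_compose2[OF assms(2)]) (auto intro!: continuous_intros)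
  then have "(\<lambda>s. k s * u (x - s)) absolutely_integrable_on {0..x}"
    by (rule absolutely_integrable_times_continuous[OF assms(1)])
  from reflect_Icc(2)[OF this] show ?thesis by (simp add: volterra_def)
qed

text \<open>
  After reflection the argument \<open>y\<close> enters only through the continuous factor \<open>u (y - s)\<close> and the
  cut-off at \<open>s = y\<close>, so dominated convergence applies with dominating function
  \<open>\<bar>k\<bar> * sup \<bar>u\<bar>\<close>. As \<open>y\<close> tends to \<open>x\<close> the integrand
  converges except possibly at \<open>s = x\<close>, and this one point is removed.
\<close>

lemma continuous_on_volterra:
  assumes k: "k absolutely_integrable_on {0..T}" and u: "continuous_on {0..T} u" 
  shows "continuous_on {0..T} (volterra k u)"
  unfolding continuous_on_sequentially
proof safe
  fix X :: "nat \<Rightarrow> real" and x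
  assume x: "x \<in> {0..T}" and XT: "\<forall>n. X n \<in> {0..T}" and lim: "X \<longlonglongrightarrow> x"
  obtain B where B: "\<And>t. t \<in> {0..T} \<Longrightarrow> \<bar>u t\<bar> \<le> B"
    using compact_imp_bounded[OF compact_continuous_image[OF u compact_Icc]]
    by (force simp: bounded_iff)
  define F where "F y s = (if s \<in> {0..y} then k s * u (y - s) else 0)" for y s
  have rep: "F y absolutely_integrable_on {0..T} - {x}" 
       "integral ({0..T} - {x}) (F y) = volterra k u y" if y: "y \<in> {0..T}" for y
  proof -
    have ky: "k absolutely_integrable_on {0..y}" 
      using absolutely_integrable_on_initial[OF k] y by auto
    have uy: "continuous_on {0..y} u" using u y by (auto intro: continuous_on_subset)
    have "continuous_on {0..y} (\<lambda>s. u (y - s))"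
      by (rule continuous_on_compose2[OF uy]) (auto intro!: continuous_intros)
    then have int: "(\<lambda>s. k s * u (y - s)) absolutely_integrable_on {0..y}"
      by (rule absolutely_integrable_times_continuous[OF ky])
    have 1: "F y absolutely_integrable_on {0..T}"
      using int unfolding F_def absolutely_integrable_restrict_UNIV[of "{0..y}", symmetric]
      by (rule set_integrable_subset) auto
    show "F y absolutely_integrable_on {0..T} - {x}"
      by (rule absolutely_integrable_spike_set[OF 1]) (auto intro: negligible_subset[of "{x}"])
    have "integral ({0..T} - {x}) (F y) = integral {0..T} (F y)"
      by (rule integral_spike_set) (auto intro: negligible_subset[of "{x}"])
    also have "\<dots> = integral {0..y} (\<lambda>s. k s * u (y - s))"
      unfolding F_def using integral_restrict_Int[of "{0..T}" "{0..y}" "\<lambda>s. k s * u (y - s)"] y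
      by (simp add: min_absorb1)
    finally show "integral ({0..T} - {x}) (F y) = volterra k u y"
      by (simp add: volterra_reflect[OF ky uy])
  qed
  have "(\<lambda>n. integral ({0..T} - {x}) (F (X n))) \<longlonglongrightarrow> integral ({0..T} - {x}) (F x)"
  proof (rule dominated_convergence(2))
    show "F (X n) integrable_on {0..T} - {x}" for n
      using rep(1)[of "X n"] XT set_lebesgue_integral_eq_integral(1) by blast
    have "(\<lambda>s. \<bar>k s\<bar>) absolutely_integrable_on {0..T}"
      using absolutely_integrable_norm[OF k] by (simp add: o_def)
    then have "(\<lambda>s. \<bar>k s\<bar>) absolutely_integrable_on {0..T} - {x}"
      by (rule absolutely_integrable_spike_set) (auto intro: negligible_subset[of "{x}"])
    then show "(\<lambda>s. \<bar>k s\<bar> * B) integrable_on {0..T} - {x}"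
      using set_lebesgue_integral_eq_integral(1) by (intro integrable_on_mult_left) blast
  next
    fix n s assume s: "s \<in> {0..T} - {x}"
    have "B \<ge> 0" using B[OF x] by linarith
    then show "norm (F (X n) s) \<le> \<bar>k s\<bar> * B"
      using B[of "X n - s"] XT[rule_format, of n] s
      by (auto simp: F_def abs_mult intro!: mult_left_mono)
  next
    fix s assume s: "s \<in> {0..T} - {x}"
    show "(\<lambda>n. F (X n) s) \<longlonglongrightarrow> F x s"
    proof (cases "s < x")
      case True
      have ev: "eventually (\<lambda>n. X n > s) sequentially"
        using order_tendstoD(1)[OF lim True] .
      have mem: "eventually (\<lambda>n. X n - s \<in> {0..T}) sequentially"
        using ev
      proof eventually_elim
        case (elim n)
        then show ?case using XT[rule_format, of n] s by auto
      qed
      have "(\<lambda>n. u (X n - s)) \<longlonglongrightarrow> u (x - s)"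
        by (rule continuous_on_tendsto_compose[OF u _ _ mem])
           (use lim True s x in \<open>auto intro!: tendsto_intros\<close>)
      then have "(\<lambda>n. k s * u (X n - s)) \<longlonglongrightarrow> F x s"
        using s True by (auto simp: F_def intro!: tendsto_intros)
      then show ?thesis
        by (rule Lim_transform_eventually) (use ev s in \<open>auto simp: F_def elim!: eventually_mono\<close>)
    next
      case False
      then have "x < s" using s by auto
      from order_tendstoD(2)[OF lim this]
      have "eventually (\<lambda>n. F (X n) s = F x s) sequentially"
        by eventually_elim (use \<open>x < s\<close> in \<open>auto simp: F_def\<close>)
      then show ?thesis by (rule tendsto_eventually)
    qed
  qed
  then show "(volterra k u \<circ> X) \<longlonglongrightarrow> volterra k u x"
    using rep(2) x XT by (simp add: o_def)
qed

text \<open>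
  For every \<open>s > 0\<close> the weight tends to \<open>0\<close> as \<open>M\<close> grows, so this is dominated convergence again.
\<close>

lemma exponential_weight_small:
  assumes k: "(k::real \<Rightarrow> real) absolutely_integrable_on {0..T}" and e: "e > 0"
  obtains M where "integral {0..T} (\<lambda>s. \<bar>k s\<bar> * exp (- M * s)) < e"
proof -
  have k': "(\<lambda>s. \<bar>k s\<bar>) absolutely_integrable_on {0..T}"
    using absolutely_integrable_norm[OF k] by (simp add: o_def)
  let ?S = "{0..T} - {0}"
  have spk: "h integrable_on ?S" "integral ?S h = integral {0..T} h" 
    if "h absolutely_integrable_on {0..T}" for h :: "real \<Rightarrow> real"
  proof -
    have "h absolutely_integrable_on ?S"
      by (rule absolutely_integrable_spike_set[OF that]) (auto intro: negligible_subset[of "{0}"])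
    then show "h integrable_on ?S" using set_lebesgue_integral_eq_integral(1) by blast
    show "integral ?S h = integral {0..T} h"
      by (rule integral_spike_set) (auto intro: negligible_subset[of "{0}"])
  qed
  have int: "(\<lambda>s. \<bar>k s\<bar> * exp (- real n * s)) absolutely_integrable_on {0..T}" for n
    by (intro absolutely_integrable_times_continuous[OF k'] continuous_intros)
  have "(\<lambda>n. integral ?S (\<lambda>s. \<bar>k s\<bar> * exp (- real n * s))) \<longlonglongrightarrow> integral ?S (\<lambda>s. 0)"
  proof (rule dominated_convergence(2))
    show "(\<lambda>s. \<bar>k s\<bar> * exp (- real n * s)) integrable_on ?S" for n by (rule spk(1)[OF int])
    show "(\<lambda>s. \<bar>k s\<bar>) integrable_on ?S" by (rule spk(1)[OF k'])
    show "norm (\<bar>k s\<bar> * exp (- real n * s)) \<le> \<bar>k s\<bar>" if "s \<in> ?S" for n s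
      using that by (auto simp: abs_mult intro!: mult_left_le)
    fix s assume "s \<in> ?S"
    then have "norm (exp (- s)) < 1" by auto
    then have "(\<lambda>n. exp (- s) ^ n) \<longlonglongrightarrow> 0" by (rule LIMSEQ_power_zero)
    then have "(\<lambda>n. exp (- real n * s)) \<longlonglongrightarrow> 0" 
      by (simp add: exp_of_nat_mult[symmetric])
    from tendsto_mult_right_zero[OF this]
    show "(\<lambda>n. \<bar>k s\<bar> * exp (- real n * s)) \<longlonglongrightarrow> 0" by simp
  qed
  then have "(\<lambda>n. integral {0..T} (\<lambda>s. \<bar>k s\<bar> * exp (- real n * s))) \<longlonglongrightarrow> 0"
    unfolding spk(2)[OF int] by simp
  from order_tendstoD(2)[OF this e] obtain n
    where "integral {0..T} (\<lambda>s. \<bar>k s\<bar> * exp (- real n * s)) < e"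
    by (auto simp: eventually_sequentially)
  then show ?thesis by (rule that)
qed

text \<open>
  In a suitable exponentially weighted norm \<open>lam\<close> times a Volterra operator is a contraction, whatever
  the size of \<open>lam\<close> and of the interval. This gives uniqueness and geometric convergence of the Neumann
  series without any estimate of the iterated kernels.
\<close>

lemma volterra_contraction:
  assumes k: "k absolutely_integrable_on {0..T}"
  obtains M q where "0 \<le> q" "q < 1"
    "\<And>u B x. \<lbrakk>continuous_on {0..T} u; \<And>t. t \<in> {0..T} \<Longrightarrow> \<bar>u t\<bar> \<le> B * exp (M * t); x \<in> {0..T}\<rbrakk>
      \<Longrightarrow> \<bar>lam * volterra k u x\<bar> \<le> q * B * exp (M * x)"
proof -
  \<comment> \<open>This threshold makes the contraction constant at most \<open>\<bar>lam\<bar> / (\<bar>lam\<bar> + 1) < 1\<close>.\<close>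
  have "1 / (\<bar>lam\<bar> + 1) > 0" by auto
  from exponential_weight_small[OF k this] obtain M
    where M: "integral {0..T} (\<lambda>s. \<bar>k s\<bar> * exp (- M * s)) < 1 / (\<bar>lam\<bar> + 1)" (is "?I < _") .
  have I: "?I \<ge> 0" by (intro integral_nonneg_Icc) auto
  show thesis
  proof (rule that[of "\<bar>lam\<bar> * ?I" M])
    show "0 \<le> \<bar>lam\<bar> * ?I" using I by simp
    have "\<bar>lam\<bar> * ?I \<le> \<bar>lam\<bar> * (1 / (\<bar>lam\<bar> + 1))" using M by (intro mult_left_mono) auto
    also have "\<dots> < 1" by (auto simp: field_simps)
    finally show "\<bar>lam\<bar> * ?I < 1" .
    fix u :: "real \<Rightarrow> real" and B x
    assume u: "continuous_on {0..T} u" and le: "\<And>t. t \<in> {0..T} \<Longrightarrow> \<bar>u t\<bar> \<le> B * exp (M * t)"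
      and x: "x \<in> {0..T}"
    have "\<bar>u 0\<bar> \<le> B" using le[of 0] x by auto
    then have B: "B \<ge> 0" by linarith
    have int: "(\<lambda>s. \<bar>k s\<bar> * exp (- M * s)) integrable_on {0..y}" if "y \<le> T" for y
    proof -
      have "(\<lambda>s. \<bar>k s\<bar>) absolutely_integrable_on {0..y}"
        using absolutely_integrable_norm[OF absolutely_integrable_on_initial[OF k that]]
        by (simp add: o_def)
      then have "(\<lambda>s. \<bar>k s\<bar> * exp (- M * s)) absolutely_integrable_on {0..y}"
        by (intro absolutely_integrable_times_continuous continuous_intros)
      then show ?thesis using set_lebesgue_integral_eq_integral(1) by blast
    qed
    have "\<bar>volterra k u x\<bar> \<le> integral {0..x} (\<lambda>s. \<bar>k s\<bar> * exp (- M * s)) * (B * exp (M * x))"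
      using x le by (intro volterra_bound_exp absolutely_integrable_on_initial[OF k] 
          continuous_on_subset[OF u]) auto
    also have "\<dots> \<le> ?I * (B * exp (M * x))"
      using x B int by (intro mult_right_mono integral_subset_le) auto
    finally show "\<bar>lam * volterra k u x\<bar> \<le> \<bar>lam\<bar> * ?I * B * exp (M * x)"
      by (simp add: abs_mult mult_left_mono mult.assoc)
  qed
qed

text \<open>
  Iterating the equation \<open>N\<close> times gains the factor \<open>q ^ N\<close> in the weighted norm.
\<close>

lemma volterra_homogeneous_unique:
  assumes k: "k absolutely_integrable_on {0..T}" and d: "continuous_on {0..T} d"
    and eq: "\<And>x. x \<in> {0..T} \<Longrightarrow> d x = lam * volterra k d x" and x: "x \<in> {0..T}"
  shows "d x = 0"
proof -
  obtain M q where q: "0 \<le> q" "q < 1" and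
    bnd: "\<And>u B x. \<lbrakk>continuous_on {0..T} u; \<And>t. t \<in> {0..T} \<Longrightarrow> \<bar>u t\<bar> \<le> B * exp (M * t); x \<in> {0..T}\<rbrakk>
      \<Longrightarrow> \<bar>lam * volterra k u x\<bar> \<le> q * B * exp (M * x)"
    using volterra_contraction[OF k] by metis
  have "continuous_on {0..T} (\<lambda>t. d t * exp (- M * t))"
    by (intro continuous_intros d)
  then obtain B where B: "\<And>t. t \<in> {0..T} \<Longrightarrow> \<bar>d t * exp (- M * t)\<bar> \<le> B"
    using compact_imp_bounded[OF compact_continuous_image[OF _ compact_Icc]]
    by (force simp: bounded_iff)
  have it: "\<bar>d t\<bar> \<le> q ^ N * B * exp (M * t)" if "t \<in> {0..T}" for N t
    using that
  proof (induction N arbitrary: t)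
    case 0
    then show ?case using B[of t] by (simp add: abs_mult exp_minus field_simps)
  next
    case (Suc N)
    then show ?case using bnd[OF d, of "q ^ N * B" t] eq[of t] by (simp add: mult.assoc)
  qed
  have "(\<lambda>N. q ^ N * B * exp (M * x)) \<longlonglongrightarrow> 0 * B * exp (M * x)"
    using q by (intro tendsto_mult LIMSEQ_power_zero tendsto_const) auto
  then have "\<bar>d x\<bar> \<le> 0 * B * exp (M * x)"
    by (rule Lim_bounded2) (use it[OF x] in auto)
  then show ?thesis by simp
qed

text \<open>
  The sequence \<open>w\<close> lists the iterates of the operator on \<open>w 0\<close>. It is a parameter, so that the iterates
  can be supplied in closed form; then the sum of the Neumann series is at once an explicit solution.
\<close>

lemma neumann_series:
  assumes k: "k absolutely_integrable_on {0..T}" and w0: "continuous_on {0..T} (w 0)"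
    and step: "\<And>j x. x \<in> {0..T} \<Longrightarrow> w (Suc j) x = volterra k (w j) x"
  shows "\<And>x. x \<in> {0..T} \<Longrightarrow> summable (\<lambda>j. lam ^ j * w j x)"
    and "continuous_on {0..T} (\<lambda>x. \<Sum>j. lam ^ j * w j x)"
    and "\<And>x. x \<in> {0..T} \<Longrightarrow>
      (\<Sum>j. lam ^ j * w j x) = w 0 x + lam * volterra k (\<lambda>t. \<Sum>j. lam ^ j * w j t) x"
proof -
  have w: "continuous_on {0..T} (w j)" for j
  proof (induction j)
    case (Suc j)
    then show ?case using continuous_on_volterra[OF k Suc] 
      by (subst continuous_on_cong[OF refl step]) auto
  qed (rule w0)
  obtain M q where q: "0 \<le> q" "q < 1" and
    bnd: "\<And>u B x. \<lbrakk>continuous_on {0..T} u; \<And>t. t \<in> {0..T} \<Longrightarrow> \<bar>u t\<bar> \<le> B * exp (M * t); x \<in> {0..T}\<rbrakk>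
      \<Longrightarrow> \<bar>lam * volterra k u x\<bar> \<le> q * B * exp (M * x)"
    using volterra_contraction[OF k] by metis
  have "continuous_on {0..T} (\<lambda>t. w 0 t * exp (- M * t))"
    by (intro continuous_intros w0)
  then obtain B0 where B0: "\<And>t. t \<in> {0..T} \<Longrightarrow> \<bar>w 0 t * exp (- M * t)\<bar> \<le> B0"
    using compact_imp_bounded[OF compact_continuous_image[OF _ compact_Icc]]
    by (force simp: bounded_iff)
  define B where "B = max B0 0"
  have B: "\<bar>w 0 t * exp (- M * t)\<bar> \<le> B" if "t \<in> {0..T}" for t
    using B0[OF that] by (simp add: B_def)
  have it: "\<bar>lam ^ j * w j t\<bar> \<le> q ^ j * B * exp (M * t)" if "t \<in> {0..T}" for j t
    using that
  proof (induction j arbitrary: t)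
    case 0
    then show ?case using B[of t] by (simp add: abs_mult exp_minus field_simps)
  next
    case (Suc j)
    have "lam ^ Suc j * w (Suc j) t = lam * volterra k (\<lambda>t. lam ^ j * w j t) t"
      using step[OF Suc.prems, of j] absolutely_integrable_on_initial[OF k, of t] Suc.prems
      by (simp add: volterra_scale)
    moreover have "\<bar>lam * volterra k (\<lambda>t. lam ^ j * w j t) t\<bar> \<le> q * (q ^ j * B) * exp (M * t)"
      by (rule bnd) (use w Suc in \<open>auto intro: continuous_on_mult_left\<close>)
    ultimately show ?case by (simp only: power_Suc mult.assoc)
  qed
  have it': "\<bar>lam ^ j * w j t\<bar> \<le> q ^ j * (B * exp (\<bar>M\<bar> * T))" if "t \<in> {0..T}" for j t
  proof -
    have "M * t \<le> \<bar>M\<bar> * T" using that by (intro mult_mono) auto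
    then have "q ^ j * B * exp (M * t) \<le> q ^ j * B * exp (\<bar>M\<bar> * T)"
      using q by (intro mult_left_mono) (auto simp: B_def)
    then show ?thesis using it[OF that, of j] by (simp add: mult.assoc)
  qed
  have m: "summable (\<lambda>j. q ^ j * (B * exp (\<bar>M\<bar> * T)))"
    using q by (intro summable_mult2 summable_geometric) auto
  show smm: "summable (\<lambda>j. lam ^ j * w j x)" if "x \<in> {0..T}" for x
    by (rule summable_comparison_test[OF _ m]) (use it'[OF that] in auto)
  have cont: "continuous_on {0..T} (\<lambda>t. lam ^ j * w j t)" for j
    by (intro continuous_intros w)
  show "continuous_on {0..T} (\<lambda>x. \<Sum>j. lam ^ j * w j x)"
    by (rule volterra_sums(2)[OF k cont m it'])
  fix x assume x: "x \<in> {0..T}"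
  have kx: "k absolutely_integrable_on {0..x}"
    using absolutely_integrable_on_initial[OF k] x by auto
  have "(\<lambda>j. volterra k (\<lambda>t. lam ^ j * w j t) x) sums volterra k (\<lambda>t. \<Sum>j. lam ^ j * w j t) x"
    using x by (intro volterra_sums(1)[OF kx continuous_on_subset[OF cont] m] it') auto
  moreover have "volterra k (\<lambda>t. lam ^ j * w j t) x = lam ^ j * w (Suc j) x" for j
    using step[OF x] by (simp add: volterra_scale[OF kx])
  ultimately have "(\<lambda>j. lam ^ j * w (Suc j) x) sums volterra k (\<lambda>t. \<Sum>j. lam ^ j * w j t) x"
    by simp
  from sums_mult[OF this, of lam]
  have "(\<lambda>j. lam ^ Suc j * w (Suc j) x) sums (lam * volterra k (\<lambda>t. \<Sum>j. lam ^ j * w j t) x)"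
    by (simp add: mult.assoc)
  then have "(\<lambda>j. lam ^ j * w j x) sums (lam * volterra k (\<lambda>t. \<Sum>j. lam ^ j * w j t) x + lam ^ 0 * w 0 x)"
    by (subst (asm) sums_Suc_iff) simp
  then show "(\<Sum>j. lam ^ j * w j x) = w 0 x + lam * volterra k (\<lambda>t. \<Sum>j. lam ^ j * w j t) x"
    by (simp add: sums_iff)
qed

section \<open>Series estimates\<close>

text \<open>
  Summation of a double series along its diagonals. The Cauchy product of two series is the special
  case of products; here the terms may contain a further factor depending on \<open>i + l\<close>.
\<close>

lemma double_series_diagonal:
  fixes f :: "nat \<Rightarrow> nat \<Rightarrow> real"
  assumes p: "summable p" "\<And>i. 0 \<le> p i" and q: "summable q" "\<And>l. 0 \<le> q l"
    and le: "\<And>i l. \<bar>f i l\<bar> \<le> p i * q l"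
  shows "(\<lambda>k. \<Sum>i\<le>k. f i (k - i)) sums (\<Sum>i. \<Sum>l. f i l)"
proof -
  have pq: "(\<lambda>z. norm (case z of (i, l) \<Rightarrow> p i * q l)) summable_on (UNIV \<times> UNIV)"
  proof (rule iffD2[OF Infinite_Sum.abs_summable_on_Sigma_iff], intro conjI ballI)
    fix i
    have "summable (\<lambda>l. norm (p i * q l))" 
      using p q by (simp add: abs_mult summable_mult)
    then show "(\<lambda>l. norm (case (i, l) of (i, l) \<Rightarrow> p i * q l)) summable_on UNIV"
      by (auto intro: summable_nonneg_imp_summable_on)
  next
    have 1: "infsum (\<lambda>l. p i * q l) UNIV = p i * suminf q" for i
    proof (rule infsumI)
      have "(q has_sum suminf q) UNIV" 
        using q by (intro sums_nonneg_imp_has_sum summable_sums) auto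
      then show "((\<lambda>l. p i * q l) has_sum p i * suminf q) UNIV"
        by (rule has_sum_cmult_right)
    qed
    have "(\<lambda>i. p i * suminf q) summable_on UNIV"
      using p q by (intro summable_nonneg_imp_summable_on summable_mult2 mult_nonneg_nonneg suminf_nonneg) auto
    moreover have "norm (p i * q l) = p i * q l" for i l
      using p(2)[of i] q(2)[of l] by simp
    ultimately show "(\<lambda>i. norm (infsum (\<lambda>l. norm (case (i, l) of (i, l) \<Rightarrow> p i * q l)) UNIV)) summable_on UNIV"
      using p q by (simp add: 1 abs_mult suminf_nonneg)
  qed
  have "(\<lambda>z. norm (case z of (i, l) \<Rightarrow> f i l)) summable_on (UNIV \<times> UNIV)"
  proof (rule Infinite_Sum.abs_summable_on_comparison_test[OF pq])
    fix z :: "nat \<times> nat"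
    obtain i l where z: "z = (i, l)" by force
    show "norm (case z of (i, l) \<Rightarrow> f i l) \<le> norm (case z of (i, l) \<Rightarrow> p i * q l)"
      using le[of i l] abs_ge_self[of "p i * q l"] unfolding z by simp
  qed
  then have sm: "(\<lambda>(i, l). f i l) summable_on (UNIV \<times> UNIV)"
    by (rule Infinite_Sum.abs_summable_summable)
  then obtain S where S: "((\<lambda>(i, l). f i l) has_sum S) (UNIV \<times> UNIV)"
    by (auto simp: summable_on_def)
  have row: "(f i has_sum (\<Sum>l. f i l)) UNIV" for i
  proof -
    have row_abs: "summable (\<lambda>l. norm (f i l))"
      by (rule summable_comparison_test[OF _ summable_mult[OF q(1), of "p i"]]) (use le in auto)
    show ?thesis
      by (rule norm_summable_imp_has_sum[OF row_abs summable_sums[OF summable_norm_cancel[OF row_abs]]])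
  qed
  have "((\<lambda>i. \<Sum>l. f i l) has_sum S) UNIV"
    by (rule has_sum_SigmaD[OF S]) (use row in auto)
  then have rows: "(\<Sum>i. \<Sum>l. f i l) = S"
    using has_sum_imp_sums sums_unique by blast
  have "((\<lambda>(k, i). f i (k - i)) has_sum S) (Sigma UNIV (\<lambda>k. {..k}))"
    using S
    by (subst has_sum_reindex_bij_witness[of _ "\<lambda>(i, l). (i + l, i)" "\<lambda>(k, i). (i, k - i)"]) auto
  then have "((\<lambda>k. \<Sum>i\<le>k. f i (k - i)) has_sum S) UNIV"
    by (rule has_sum_SigmaD) (auto intro!: has_sum_finiteI)
  then show ?thesis unfolding rows by (rule has_sum_imp_sums)
qed

text \<open>
  Replacing \<open>\<gamma>\<close> by \<open>\<bar>\<gamma>\<bar>\<close> gives a majorant with nonnegative terms, which is the binomial series of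
  \<open>(1 - z) powr (- \<bar>\<gamma>\<bar>)\<close>.
\<close>

lemma summable_abs_pochhammer:
  fixes \<gamma> z :: real
  assumes "0 \<le> z" "z < 1"
  shows "summable (\<lambda>k. \<bar>pochhammer \<gamma> k / fact k\<bar> * z ^ k)"
proof -
  have "summable (\<lambda>k. (- \<bar>\<gamma>\<bar> gchoose k) * (- z) ^ k)"
    using gen_binomial_real[of "- z" "- \<bar>\<gamma>\<bar>"] assms by (auto simp: sums_iff)
  moreover have "(- \<bar>\<gamma>\<bar> gchoose k) * (- z) ^ k = pochhammer \<bar>\<gamma>\<bar> k / fact k * z ^ k" for k
  proof -
    have "(- 1) ^ k * (- z) ^ k = z ^ k" by (simp flip: power_mult_distrib)
    then show ?thesis by (simp add: gbinomial_pochhammer mult_ac)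
  qed
  ultimately have "summable (\<lambda>k. pochhammer \<bar>\<gamma>\<bar> k / fact k * z ^ k)" by simp
  moreover have "\<bar>pochhammer \<gamma> k\<bar> \<le> pochhammer \<bar>\<gamma>\<bar> k" for k
    unfolding pochhammer_prod abs_prod by (intro prod_mono) auto
  ultimately show ?thesis
    using assms by (elim summable_comparison_test[rotated]) (auto simp: abs_mult intro!: mult_right_mono divide_right_mono)
qed

text \<open>
  The Gamma function grows faster than every exponential. On \<open>[Q, Q + 1]\<close> the integrand of
  \<open>Gamma (y + 1)\<close> is at least \<open>Q powr y * exp (- (Q + 1))\<close>. The functional equation brings the argument
  back to \<open>y\<close> at the cost of a factor \<open>y \<le> exp y\<close>, and \<open>Q = exp 1 * R\<close> is chosen to absorb that factor.
\<close>

lemma inverse_Gamma_bound: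
  fixes y R :: real
  assumes "y > 0" "R > 0"
  shows "1 / Gamma y \<le> exp (exp 1 * R + 1) * R powr (- y)"
proof -
  define Q where "Q = exp 1 * R"
  have Q: "Q > 0" using assms by (simp add: Q_def)
  have "Q powr y * exp (- (Q + 1)) = integral {Q..Q+1} (\<lambda>t. Q powr y * exp (- (Q + 1)))"
    by simp
  also have "\<dots> \<le> integral {Q..Q+1} (\<lambda>t. t powr (y + 1 - 1) / exp t)"
  proof (rule integral_le)
    show "(\<lambda>t. t powr (y + 1 - 1) / exp t) integrable_on {Q..Q+1}"
      using Q by (intro integrable_continuous_real continuous_intros) auto
    fix t assume "t \<in> {Q..Q+1}"
    then have "Q powr y * exp (- (Q + 1)) \<le> t powr y * exp (- t)"
      using assms Q by (intro mult_mono powr_mono2) auto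
    then show "Q powr y * exp (- (Q + 1)) \<le> t powr (y + 1 - 1) / exp t"
      by (simp add: exp_minus field_simps)
  qed auto
  also have "\<dots> \<le> integral {0..} (\<lambda>t. t powr (y + 1 - 1) / exp t)"
    using Q Gamma_integral_real[of "y + 1"] assms
    by (intro integral_subset_le integrable_continuous_real continuous_intros) 
       (auto simp: has_integral_iff)
  also have "\<dots> = Gamma (y + 1)"
    using Gamma_integral_real[of "y + 1"] assms by (auto simp: has_integral_iff)
  also have "\<dots> = y * Gamma y" using assms by (intro Gamma_plus1) auto
  also have "\<dots> \<le> exp y * Gamma y"
    using assms exp_ge_add_one_self[of y]
    by (intro mult_right_mono) (linarith, auto intro: less_imp_le)
  finally have "exp (- y) * (Q powr y * exp (- (Q + 1))) \<le> exp (- y) * (exp y * Gamma y)"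
    by (intro mult_left_mono) auto
  also have "exp (- y) * (exp y * Gamma y) = Gamma y" by (simp flip: mult.assoc exp_add)
  also have "exp (- y) * (Q powr y * exp (- (Q + 1))) = R powr y * exp (- (Q + 1))"
    using assms by (simp add: Q_def powr_def ln_mult algebra_simps flip: exp_add)
  finally have "1 / Gamma y \<le> 1 / (R powr y * exp (- (Q + 1)))"
    using assms by (intro divide_left_mono) auto
  also have "\<dots> = exp (Q + 1) * R powr (- y)"
    by (simp only: exp_minus powr_minus) (simp add: field_simps)
  finally show ?thesis by (simp add: Q_def)
qed

lemma ex_small_powr:
  fixes r \<rho> :: real
  assumes "r \<ge> 0" "\<rho> > 0"
  obtains S where "S > 0" "r * S powr \<rho> < 1"
proof
  show "(1 / (r + 1)) powr (1 / \<rho>) > 0" using assms by simp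
  show "r * ((1 / (r + 1)) powr (1 / \<rho>)) powr \<rho> < 1"
    using assms by (simp add: powr_powr field_simps)
qed

text \<open>
  By the Gamma bound with \<open>R = 1 / S\<close> the terms are dominated by those of a binomial series at
  \<open>\<bar>r\<bar> * S powr \<rho>\<close>, and \<open>S\<close> may be taken so small that this number is below \<open>1\<close>.
\<close>

lemma mittag_leffler_abs_summable:
  fixes r \<rho> \<alpha> \<gamma> :: real
  assumes "\<rho> > 0" "\<alpha> > 0"
  shows "summable (\<lambda>k. \<bar>pochhammer \<gamma> k / Gamma (\<rho> * real k + \<alpha>) * (r ^ k / fact k)\<bar>)"
proof -
  obtain S where S: "S > 0" "\<bar>r\<bar> * S powr \<rho> < 1" using ex_small_powr[of "\<bar>r\<bar>" \<rho>] assms by auto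
  define E where "E = exp (exp 1 * (1 / S) + 1)"
  have le: "\<bar>pochhammer \<gamma> k / Gamma (\<rho> * real k + \<alpha>) * (r ^ k / fact k)\<bar>
      \<le> \<bar>pochhammer \<gamma> k / fact k\<bar> * (\<bar>r\<bar> * S powr \<rho>) ^ k * (E * S powr \<alpha>)" for k
  proof -
    have pos: "\<rho> * real k + \<alpha> > 0" using assms by (simp add: add_nonneg_pos)
    have "1 / Gamma (\<rho> * real k + \<alpha>) \<le> E * (1 / S) powr (- (\<rho> * real k + \<alpha>))"
      unfolding E_def by (rule inverse_Gamma_bound[OF pos]) (use S in auto)
    also have "(1 / S) powr (- (\<rho> * real k + \<alpha>)) = (S powr \<rho>) ^ k * S powr \<alpha>"
    proof -
      have "(1 / S) powr (- (\<rho> * real k + \<alpha>)) = S powr (\<rho> * real k + \<alpha>)"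
        using S by (simp only: powr_minus powr_divide powr_one_eq_one) simp
      then show ?thesis
        using S by (simp add: powr_add powr_powr flip: powr_realpow)
    qed
    finally have g: "1 / Gamma (\<rho> * real k + \<alpha>) \<le> E * ((S powr \<rho>) ^ k * S powr \<alpha>)" .
    have "\<bar>pochhammer \<gamma> k / Gamma (\<rho> * real k + \<alpha>) * (r ^ k / fact k)\<bar>
        = \<bar>pochhammer \<gamma> k / fact k\<bar> * \<bar>r\<bar> ^ k * (1 / Gamma (\<rho> * real k + \<alpha>))"
      using Gamma_real_pos[OF pos] by (simp add: abs_mult power_abs)
    also have "\<dots> \<le> \<bar>pochhammer \<gamma> k / fact k\<bar> * \<bar>r\<bar> ^ k * (E * ((S powr \<rho>) ^ k * S powr \<alpha>))"
      by (intro mult_left_mono g) auto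
    finally show ?thesis by (simp add: power_mult_distrib mult_ac)
  qed
  show ?thesis
    by (rule summable_comparison_test[OF _ summable_mult2[OF summable_abs_pochhammer[of "\<bar>r\<bar> * S powr \<rho>" \<gamma>]]])
       (use le S in auto)
qed

section \<open>Riemann-Liouville integrals\<close>

text \<open>
  The operator \<open>volterra (power_kernel p)\<close> is the Riemann-Liouville integral of order \<open>p\<close>; the prefix
  \<open>RL\<close> marks statements about it.
\<close>

definition power_kernel :: "real \<Rightarrow> real \<Rightarrow> real" where
  "power_kernel p s = s powr (p - 1) / Gamma p"

lemma power_kernel_integral:
  assumes "p > 0" "x \<ge> 0"
  shows "(power_kernel p has_integral x powr p / Gamma (p + 1)) {0..x}"
proof -
  have "((\<lambda>s. s powr (p - 1) / Gamma p) has_integral (x powr (p - 1 + 1) / (p - 1 + 1)) / Gamma p) {0..x}"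
    using assms by (intro has_integral_divide has_integral_powr_from_0) auto
  moreover have "Gamma (p + 1) = p * Gamma p" using assms by (intro Gamma_plus1) auto
  ultimately show ?thesis by (simp add: power_kernel_def[abs_def])
qed

lemma power_kernel_nonneg: "p > 0 \<Longrightarrow> 0 \<le> power_kernel p s"
  by (auto simp: power_kernel_def intro!: divide_nonneg_nonneg intro: less_imp_le)

lemma power_kernel_integrable:
  assumes "p > 0"
  shows "power_kernel p absolutely_integrable_on {0..x}"
proof (cases "x \<ge> 0")
  case True
  then show ?thesis
    using power_kernel_integral[OF assms True] power_kernel_nonneg[OF assms]
    by (intro nonnegative_absolutely_integrable_1) auto
qed auto

lemma RL_bound:
  assumes "p > 0" "x \<ge> 0" "continuous_on {0..x} u" "\<And>t. t \<in> {0..x} \<Longrightarrow> \<bar>u t\<bar> \<le> U"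
  shows "\<bar>volterra (power_kernel p) u x\<bar> \<le> x powr p / Gamma (p + 1) * U"
proof -
  have "integral {0..x} (\<lambda>s. \<bar>power_kernel p s\<bar>) = x powr p / Gamma (p + 1)"
    using power_kernel_integral[OF assms(1,2)] power_kernel_nonneg[OF assms(1)]
    by (simp add: has_integral_iff)
  then show ?thesis
    using volterra_bound[OF power_kernel_integrable[OF assms(1)] assms(3,4)] by simp
qed

text \<open>
  The operator norm on \<open>[0,x]\<close> is bounded by a multiple of \<open>S powr p\<close> for every \<open>S > 0\<close>, with a factor that does
  not depend on the order \<open>p\<close>. Sums and double sums over different orders are thereby dominated by products
  of convergent series.
\<close>

lemma RL_bound_geometric:
  assumes S: "S > 0"
  obtains C where "C \<ge> 0"
    "\<And>p u t U. \<lbrakk>p > 0; t \<in> {0..x}; continuous_on {0..t} u; \<And>s. s \<in> {0..t} \<Longrightarrow> \<bar>u s\<bar> \<le> U\<rbrakk>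
      \<Longrightarrow> \<bar>volterra (power_kernel p) u t\<bar> \<le> C * U * S powr p"
proof -
  define R where "R = (\<bar>x\<bar> + 1) / S"
  have R: "R > 0" using S by (simp add: R_def)
  define C where "C = exp (exp 1 * R + 1) / R"
  show thesis
  proof (rule that[of C])
    show "C \<ge> 0" using R by (simp add: C_def)
    fix p U t :: real and u :: "real \<Rightarrow> real"
    assume p: "p > 0" and t: "t \<in> {0..x}" and u: "continuous_on {0..t} u"
      and U: "\<And>s. s \<in> {0..t} \<Longrightarrow> \<bar>u s\<bar> \<le> U"
    have "U \<ge> 0" using U[of 0] t by auto
    have "\<bar>volterra (power_kernel p) u t\<bar> \<le> t powr p * (1 / Gamma (p + 1)) * U"
      using RL_bound[OF p _ u U] t by simp
    also have "\<dots> \<le> (\<bar>x\<bar> + 1) powr p * (exp (exp 1 * R + 1) * R powr (- (p + 1))) * U"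
      using p t \<open>U \<ge> 0\<close> R less_imp_le[OF Gamma_real_pos[of "p + 1"]]
      by (intro mult_right_mono mult_mono powr_mono2 inverse_Gamma_bound) auto
    also have "\<dots> = C * U * S powr p"
    proof -
      have "R powr (- (p + 1)) = 1 / (R * R powr p)"
        using R by (simp add: powr_minus_divide powr_add mult.commute del: minus_add_distrib)
      moreover have "(\<bar>x\<bar> + 1) powr p / R powr p = S powr p"
        using S by (simp add: R_def powr_divide)
      moreover have "(\<bar>x\<bar> + 1) powr p * (exp (exp 1 * R + 1) * (1 / (R * R powr p))) * U
          = exp (exp 1 * R + 1) / R * U * ((\<bar>x\<bar> + 1) powr p / R powr p)"
        using R by (simp add: field_simps)
      ultimately show ?thesis
        by (simp only: C_def)
    qed
    finally show "\<bar>volterra (power_kernel p) u t\<bar> \<le> C * U * S powr p" .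
  qed
qed

text \<open>
  Rescaling \<open>[0,x]\<close> to \<open>[0,1]\<close> turns the integral into Euler's Beta integral.
\<close>

lemma RL_powr:
  assumes p: "p > 0" and q: "q > -1" and x: "x \<ge> 0"
  shows "volterra (power_kernel p) (\<lambda>t. t powr q) x = Gamma (q + 1) * x powr (p + q) / Gamma (p + q + 1)"
proof (cases "x = 0")
  case True
  then show ?thesis by (simp add: volterra_def)
next
  case False
  then have x: "x > 0" using x by auto
  have "((\<lambda>t. t powr (q + 1 - 1) * (1 - t) powr (p - 1)) has_integral Beta (q + 1) p) {0..1}"
    using p q by (intro has_integral_Beta_real) auto
  from has_integral_stretch_real[OF this, of "1 / x"]
  have "((\<lambda>t. (t / x) powr q * (1 - t / x) powr (p - 1)) has_integral x * Beta (q + 1) p) ((\<lambda>t. t * x) ` {0..1})"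
    using x by simp
  also have "(\<lambda>t. t * x) ` {0..1} = {0..x}"
    using x image_mult_atLeastAtMost[of x 0 1] by (simp add: mult.commute)
  finally have "((\<lambda>t. (x powr (p + q - 1) / Gamma p) * ((t / x) powr q * (1 - t / x) powr (p - 1)))
      has_integral (x powr (p + q - 1) / Gamma p) * (x * Beta (q + 1) p)) {0..x}"
    by (rule has_integral_mult_right)
  also have "?this \<longleftrightarrow> ((\<lambda>t. power_kernel p (x - t) * t powr q)
      has_integral (x powr (p + q - 1) / Gamma p) * (x * Beta (q + 1) p)) {0..x}"
  proof (rule has_integral_cong)
    fix t assume t: "t \<in> {0..x}"
    have "1 - t / x = (x - t) / x" using x by (simp add: field_simps)
    then have "(t / x) powr q * (1 - t / x) powr (p - 1) = t powr q * (x - t) powr (p - 1) / (x powr q * x powr (p - 1))"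
      using t x by (simp add: powr_divide)
    also have "x powr q * x powr (p - 1) = x powr (p + q - 1)" 
      by (simp add: powr_add[symmetric] algebra_simps)
    finally show "(x powr (p + q - 1) / Gamma p) * ((t / x) powr q * (1 - t / x) powr (p - 1)) 
        = power_kernel p (x - t) * t powr q"
      using x by (simp add: power_kernel_def)
  qed
  finally have "volterra (power_kernel p) (\<lambda>t. t powr q) x = (x powr (p + q - 1) / Gamma p) * (x * Beta (q + 1) p)"
    by (simp add: volterra_def has_integral_iff)
  also have "x powr (p + q - 1) * x = x powr (p + q)" using x by (simp add: powr_diff)
  then have "(x powr (p + q - 1) / Gamma p) * (x * Beta (q + 1) p) = x powr (p + q) * Beta (q + 1) p / Gamma p"
    by (simp add: field_simps)
  also have "\<dots> = Gamma (q + 1) * x powr (p + q) / Gamma (p + q + 1)"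
    using Gamma_real_pos[OF p] by (simp add: Beta_def field_simps add_ac)
  finally show ?thesis .
qed

lemma RL_monomial:
  assumes "p > 0" "x \<ge> 0"
  shows "volterra (power_kernel p) (\<lambda>t. t ^ m) x = fact m * x powr (p + m) / Gamma (p + m + 1)"
proof -
  have "volterra (power_kernel p) (\<lambda>t. t ^ m) x = volterra (power_kernel p) (\<lambda>t. t powr real m) x"
    by (rule volterra_cong_Ioc) (simp add: powr_realpow)
  also have "\<dots> = Gamma (real m + 1) * x powr (p + m) / Gamma (p + m + 1)"
    by (rule RL_powr) (use assms in auto)
  also have "Gamma (real m + 1) = fact m" by (simp add: Gamma_fact add.commute)
  finally show ?thesis .
qed

text \<open>
  Instead of exchanging the order of two singular integrals, density is used: both sides are bounded
  linear functionals of \<open>u\<close> in the supremum norm and agree on monomials by the Beta integral, hence they agree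
  on all continuous functions by the Weierstrass approximation theorem.
\<close>

lemma RL_semigroup:
  assumes p: "p > 0" and q: "q > 0" and x: "x \<ge> 0" and u: "continuous_on {0..x} u"
  shows "volterra (power_kernel p) (volterra (power_kernel q) u) x = volterra (power_kernel (p + q)) u x"
proof -
  note ki = power_kernel_integrable
  define D where "D u = volterra (power_kernel p) (volterra (power_kernel q) u) x - volterra (power_kernel (p + q)) u x"
    for u
  have cont: "continuous_on {0..x} (volterra (power_kernel q) v)" if "continuous_on {0..x} v" for v
    by (rule continuous_on_volterra[OF ki[OF q] that])
  have Ddiff: "D (\<lambda>t. v t - w t) = D v - D w" 
    if v: "continuous_on {0..x} v" and w: "continuous_on {0..x} w" for v w
  proof -
    have "volterra (power_kernel q) (\<lambda>t. v t - w t) t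
        = volterra (power_kernel q) v t - volterra (power_kernel q) w t" if "t \<in> {0..x}" for t
      using that q v w by (intro volterra_diff ki) (auto elim: continuous_on_subset)
    then have "volterra (power_kernel p) (volterra (power_kernel q) (\<lambda>t. v t - w t)) x
       = volterra (power_kernel p) (\<lambda>t. volterra (power_kernel q) v t - volterra (power_kernel q) w t) x"
      by (intro volterra_cong)
    then show ?thesis
      using v w p q by (simp add: D_def volterra_diff[OF ki] cont)
  qed
  have Dpoly: "D (\<lambda>t. \<Sum>i\<le>n. a i * t ^ i) = 0" for a and n :: nat
  proof -
    have RLpoly: "volterra (power_kernel r) (\<lambda>t. \<Sum>i\<le>n. a i * t ^ i) t
        = (\<Sum>i\<le>n. a i * (fact i * t powr (r + i) / Gamma (r + i + 1)))" if "r > 0" "t \<ge> 0" for r t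
      using that by (subst volterra_sum[OF ki])
         (auto intro!: sum.cong continuous_intros simp: volterra_scale[OF ki] RL_monomial)
    have "volterra (power_kernel p) (volterra (power_kernel q) (\<lambda>t. \<Sum>i\<le>n. a i * t ^ i)) x
      = volterra (power_kernel p) (\<lambda>t. \<Sum>i\<le>n. (a i * fact i / Gamma (q + i + 1)) * t powr (q + i)) x"
      by (rule volterra_cong) (use q in \<open>auto simp: RLpoly intro!: sum.cong\<close>)
    also have "\<dots> = (\<Sum>i\<le>n. (a i * fact i / Gamma (q + i + 1)) * volterra (power_kernel p) (\<lambda>t. t powr (q + i)) x)"
      using p q by (subst volterra_sum[OF ki])
        (auto intro!: continuous_intros continuous_on_powr' simp only: volterra_scale[OF ki[OF p]], auto)
    also have "\<dots> = (\<Sum>i\<le>n. a i * (fact i * x powr (p + q + i) / Gamma (p + q + i + 1)))"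
    proof (intro sum.cong refl)
      fix i
      define G where "G = Gamma (q + real i + 1)"
      have "G > 0" unfolding G_def using q by (intro Gamma_real_pos) auto
      moreover have "volterra (power_kernel p) (\<lambda>t. t powr (q + i)) x
          = G * x powr (p + q + i) / Gamma (p + q + i + 1)"
        using p q x by (subst RL_powr) (auto simp: G_def add_ac)
      ultimately show "(a i * fact i / Gamma (q + i + 1)) * volterra (power_kernel p) (\<lambda>t. t powr (q + i)) x 
          = a i * (fact i * x powr (p + q + i) / Gamma (p + q + i + 1))"
        by (simp flip: G_def)
    qed
    also have "\<dots> = volterra (power_kernel (p + q)) (\<lambda>t. \<Sum>i\<le>n. a i * t ^ i) x"
      using p q x by (subst RLpoly) auto
    finally show ?thesis by (simp add: D_def)
  qed
  define K where "K = x powr p / Gamma (p + 1) * (x powr q / Gamma (q + 1)) + x powr (p + q) / Gamma (p + q + 1)"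
  have K: "K \<ge> 0"
    using p q by (auto simp: K_def intro!: add_nonneg_nonneg mult_nonneg_nonneg divide_nonneg_nonneg less_imp_le[OF Gamma_real_pos])
  have Dbound: "\<bar>D v\<bar> \<le> K * e" if v: "continuous_on {0..x} v" and e: "\<And>t. t \<in> {0..x} \<Longrightarrow> \<bar>v t\<bar> \<le> e" for v e
  proof -
    have "e \<ge> 0" using e[of 0] x by auto
    have "\<bar>volterra (power_kernel q) v t\<bar> \<le> x powr q / Gamma (q + 1) * e" if t: "t \<in> {0..x}" for t
    proof -
      have "\<bar>volterra (power_kernel q) v t\<bar> \<le> t powr q / Gamma (q + 1) * e"
        using t e q by (intro RL_bound) (auto intro: continuous_on_subset[OF v])
      also have "\<dots> \<le> x powr q / Gamma (q + 1) * e"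
        using t q \<open>e \<ge> 0\<close> by (intro mult_right_mono divide_right_mono powr_mono2 less_imp_le[OF Gamma_real_pos]) auto
      finally show ?thesis .
    qed
    from RL_bound[OF p x cont[OF v] this] RL_bound[OF _ x v e, of "p + q"] p q
    show ?thesis by (simp add: D_def K_def algebra_simps)
  qed
  have "\<bar>D u\<bar> \<le> 0 + e" if e: "e > 0" for e
  proof -
    obtain g where g: "real_polynomial_function g" "\<And>t. t \<in> {0..x} \<Longrightarrow> \<bar>u t - g t\<bar> < e / (K + 1)"
      using Stone_Weierstrass_real_polynomial_function[OF compact_Icc u, of "e / (K + 1)"] e K by auto
    obtain a n where ga: "g = (\<lambda>t. \<Sum>i\<le>n. a i * t ^ i)"
      using g(1) by (auto simp: real_polynomial_function_iff_sum)
    have gc: "continuous_on {0..x} g" unfolding ga by (intro continuous_intros)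
    have "D u = D (\<lambda>t. u t - g t)" using Ddiff[OF u gc] Dpoly[where a=a and n=n] by (simp add: ga)
    also have "\<bar>\<dots>\<bar> \<le> K * (e / (K + 1))"
      by (rule Dbound) (use g u gc in \<open>auto intro!: continuous_intros intro: less_imp_le\<close>)
    also have "\<dots> \<le> e" using K e by (simp add: field_simps)
    finally show ?thesis by simp
  qed
  then have "\<bar>D u\<bar> \<le> 0" by (rule field_le_epsilon)
  then show ?thesis by (simp add: D_def)
qed

section \<open>Prabhakar integrals\<close>

definition prabhakar_kernel :: "real \<Rightarrow> real \<Rightarrow> real \<Rightarrow> real \<Rightarrow> real \<Rightarrow> real" where
  "prabhakar_kernel \<rho> \<omega> \<gamma> \<alpha> s = rpow s (\<alpha> - 1) * mittag_leffler \<gamma> \<rho> \<alpha> (\<omega> * rpow s \<rho>)"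

definition prabhakar_coeff :: "real \<Rightarrow> real \<Rightarrow> nat \<Rightarrow> real" where
  "prabhakar_coeff \<omega> \<gamma> k = pochhammer \<gamma> k / fact k * \<omega> ^ k"

text \<open>
  This is the Chu-Vandermonde identity. It says that the power series with these coefficients,
  \<open>(1 - \<omega> z) powr (- \<gamma>)\<close>, multiply by adding the parameter \<open>\<gamma>\<close>.
\<close>

lemma prabhakar_coeff_add:
  "(\<Sum>i\<le>k. prabhakar_coeff \<omega> \<gamma> i * prabhakar_coeff \<omega> \<delta> (k - i)) = prabhakar_coeff \<omega> (\<gamma> + \<delta>) k"
proof -
  have "prabhakar_coeff \<omega> (\<gamma> + \<delta>) k
      = (\<Sum>i\<le>k. of_nat (k choose i) * pochhammer \<gamma> i * pochhammer \<delta> (k - i) / fact k * \<omega> ^ k)"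
    by (simp add: prabhakar_coeff_def pochhammer_binomial_sum sum_distrib_right sum_divide_distrib)
  also have "\<dots> = (\<Sum>i\<le>k. prabhakar_coeff \<omega> \<gamma> i * prabhakar_coeff \<omega> \<delta> (k - i))"
  proof (intro sum.cong refl)
    fix i assume i: "i \<in> {..k}"
    then have "real (k choose i) = fact k / (fact i * fact (k - i))"
      by (simp add: binomial_fact)
    moreover have "\<omega> ^ k = \<omega> ^ i * \<omega> ^ (k - i)" using i by (simp flip: power_add)
    ultimately show "of_nat (k choose i) * pochhammer \<gamma> i * pochhammer \<delta> (k - i) / fact k * \<omega> ^ k
        = prabhakar_coeff \<omega> \<gamma> i * prabhakar_coeff \<omega> \<delta> (k - i)"
      by (simp add: prabhakar_coeff_def)
  qed
  finally show ?thesis ..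
qed

context
  fixes \<rho> \<omega> :: real
  assumes \<rho>: "\<rho> > 0"
begin

lemma isCont_mittag_leffler:
  assumes "\<alpha> > 0"
  shows "isCont (mittag_leffler \<gamma> \<rho> \<alpha>) z"
proof -
  have "summable (\<lambda>k. pochhammer \<gamma> k / Gamma (\<rho> * real k + \<alpha>) / fact k * y ^ k)" for y
    using summable_rabs_cancel[OF mittag_leffler_abs_summable[OF \<rho> assms, of \<gamma> y]] by simp
  from isCont_powser_converges_everywhere[OF this] show ?thesis
    by (simp add: mittag_leffler_def[abs_def])
qed

lemma continuous_on_mittag_leffler_rpow:
  assumes "\<alpha> > 0"
  shows "continuous_on {0..x} (\<lambda>s. mittag_leffler \<gamma> \<rho> \<alpha> (\<omega> * rpow s \<rho>))"
proof -
  have inner: "continuous_on {0..x} (\<lambda>s. \<omega> * rpow s \<rho>)"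
    using \<rho> by (auto simp: rpow_def intro!: continuous_intros continuous_on_powr')
  have outer: "continuous_on UNIV (mittag_leffler \<gamma> \<rho> \<alpha>)"
    using isCont_mittag_leffler[OF assms] by (simp add: continuous_at_imp_continuous_on)
  show ?thesis
    by (rule continuous_on_compose2[OF outer inner subset_UNIV])
qed

lemma prabhakar_kernel_integrable:
  assumes "\<alpha> > 0"
  shows "prabhakar_kernel \<rho> \<omega> \<gamma> \<alpha> absolutely_integrable_on {0..x}"
proof -
  let ?E = "\<lambda>s. mittag_leffler \<gamma> \<rho> \<alpha> (\<omega> * rpow s \<rho>)"
  have "(\<lambda>s. power_kernel \<alpha> s * (Gamma \<alpha> * ?E s)) absolutely_integrable_on {0..x}"
    by (rule absolutely_integrable_times_continuous[OF power_kernel_integrable[OF assms]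
          continuous_on_mult_left[OF continuous_on_mittag_leffler_rpow[OF assms]]])
  moreover have "prabhakar_kernel \<rho> \<omega> \<gamma> \<alpha> s = power_kernel \<alpha> s * (Gamma \<alpha> * ?E s)"
    if "s \<in> {0..x} - {0}" for s
    using that Gamma_real_pos[OF assms] by (simp add: prabhakar_kernel_def power_kernel_def rpow_def)
  ultimately show ?thesis
    by (rule absolutely_integrable_spike[OF _ negligible_sing])
qed

text \<open>
  Integrating the Mittag-Leffler series term by term writes the operator as a power series in
  the Riemann-Liouville integral of order \<open>\<rho>\<close>, formally
  \<open>I\<^sup>\<alpha> (1 - \<omega> I\<^sup>\<rho>) powr (- \<gamma>)\<close>. Only the factor \<open>(x - t) powr (\<alpha> - 1)\<close> is singular, so
  the remaining factors can be regarded as a uniformly convergent series of continuous functions of \<open>t\<close> to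
  which a single Riemann-Liouville integral is applied.
\<close>

lemma prabhakar_sums:
  assumes \<alpha>: "\<alpha> > 0" and u: "continuous_on {0..x} u" and x: "x \<ge> 0"
  shows "(\<lambda>k. prabhakar_coeff \<omega> \<gamma> k * volterra (power_kernel (\<rho> * k + \<alpha>)) u x)
    sums volterra (prabhakar_kernel \<rho> \<omega> \<gamma> \<alpha>) u x"
proof -
  obtain U where U: "\<And>t. t \<in> {0..x} \<Longrightarrow> \<bar>u t\<bar> \<le> U"
    using compact_imp_bounded[OF compact_continuous_image[OF u compact_Icc]]
    by (force simp: bounded_iff)
  have "U \<ge> 0" using U[of 0] x by auto
  have G: "Gamma \<alpha> > 0" using \<alpha> by simp
  define b where "b k = pochhammer \<gamma> k / Gamma (\<rho> * real k + \<alpha>) * (\<omega> ^ k / fact k)" for k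
  define v where "v k t = b k * ((x - t) powr \<rho>) ^ k * (Gamma \<alpha> * u t)" for k t
  have b_abs: "summable (\<lambda>k. \<bar>b k * y ^ k\<bar>)" for y
    using mittag_leffler_abs_summable[OF \<rho> \<alpha>, of \<gamma> "\<omega> * y"]
    by (simp add: b_def power_mult_distrib mult_ac)
  have E_sums: "(\<lambda>k. b k * y ^ k) sums mittag_leffler \<gamma> \<rho> \<alpha> (\<omega> * y)" for y
    using summable_sums[OF summable_rabs_cancel[OF b_abs[of y]]]
    by (simp add: mittag_leffler_def b_def power_mult_distrib mult_ac)
  have cont: "continuous_on {0..x} (v k)" for k
    unfolding v_def using \<rho> by (intro continuous_intros continuous_on_powr' u) auto
  have sm: "summable (\<lambda>k. \<bar>b k * (x powr \<rho>) ^ k\<bar> * (Gamma \<alpha> * U))"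
    by (intro summable_mult2 b_abs)
  have le: "\<bar>v k t\<bar> \<le> \<bar>b k * (x powr \<rho>) ^ k\<bar> * (Gamma \<alpha> * U)" if t: "t \<in> {0..x}" for k t
  proof -
    have pow_le: "((x - t) powr \<rho>) ^ k \<le> (x powr \<rho>) ^ k"
      using t \<rho> by (intro power_mono powr_mono2) auto
    have "\<bar>v k t\<bar> = \<bar>b k\<bar> * ((x - t) powr \<rho>) ^ k * (Gamma \<alpha> * \<bar>u t\<bar>)"
      using G by (simp add: v_def abs_mult power_abs)
    also have "\<dots> \<le> \<bar>b k\<bar> * (x powr \<rho>) ^ k * (Gamma \<alpha> * U)"
      using U[OF t] G \<open>U \<ge> 0\<close> by (intro mult_mono pow_le) auto
    finally show ?thesis by (simp add: abs_mult power_abs)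
  qed
  have "(\<lambda>k. volterra (power_kernel \<alpha>) (v k) x) sums volterra (power_kernel \<alpha>) (\<lambda>t. \<Sum>k. v k t) x"
    by (rule volterra_sums(1)[OF power_kernel_integrable[OF \<alpha>] cont sm le])
  also have "volterra (power_kernel \<alpha>) (\<lambda>t. \<Sum>k. v k t) x = volterra (prabhakar_kernel \<rho> \<omega> \<gamma> \<alpha>) u x"
    unfolding volterra_def
  \<comment> \<open>At \<open>t = x\<close> the conventions for \<open>0\<close> to the power \<open>0\<close> differ if \<open>\<alpha> = 1\<close>.\<close>
  proof (rule integral_spike[of "{x}"])
    fix t assume t: "t \<in> {0..x} - {x}"
    have "(\<Sum>k. v k t) = mittag_leffler \<gamma> \<rho> \<alpha> (\<omega> * (x - t) powr \<rho>) * (Gamma \<alpha> * u t)"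
      unfolding v_def by (rule sums_unique[OF sums_mult2[OF E_sums], symmetric])
    then show "prabhakar_kernel \<rho> \<omega> \<gamma> \<alpha> (x - t) * u t = power_kernel \<alpha> (x - t) * (\<Sum>k. v k t)"
      using t G \<rho> by (auto simp: prabhakar_kernel_def power_kernel_def rpow_def)
  qed auto
  finally have sums_v: "(\<lambda>k. volterra (power_kernel \<alpha>) (v k) x) sums volterra (prabhakar_kernel \<rho> \<omega> \<gamma> \<alpha>) u x" .
  have "volterra (power_kernel \<alpha>) (v k) x
      = prabhakar_coeff \<omega> \<gamma> k * volterra (power_kernel (\<rho> * k + \<alpha>)) u x" for k
  proof -
    have "power_kernel \<alpha> (x - t) * v k t = prabhakar_coeff \<omega> \<gamma> k * (power_kernel (\<rho> * k + \<alpha>) (x - t) * u t)"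
      if "t \<in> {0..x}" for t
    proof (cases "t = x")
      case False
      then have "x - t > 0" using that by auto
      then have pow: "((x - t) powr \<rho>) ^ k = (x - t) powr (\<rho> * k)"
        by (simp add: powr_powr flip: powr_realpow)
      have "(x - t) powr (\<alpha> - 1) * ((x - t) powr \<rho>) ^ k = (x - t) powr (\<rho> * k + \<alpha> - 1)"
        unfolding pow powr_add[symmetric] by (simp add: algebra_simps)
      then show ?thesis
        using G by (simp add: power_kernel_def v_def b_def prabhakar_coeff_def field_simps)
    qed (simp add: power_kernel_def)
    then have "volterra (power_kernel \<alpha>) (v k) x 
        = integral {0..x} (\<lambda>t. prabhakar_coeff \<omega> \<gamma> k * (power_kernel (\<rho> * k + \<alpha>) (x - t) * u t))"
      unfolding volterra_def by (intro integral_cong)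
    then show ?thesis by (simp add: volterra_def)
  qed
  with sums_v show ?thesis by simp
qed

text \<open>
  A single Riemann-Liouville integral shifts all orders in the expansion by the same amount and leaves the
  coefficients unchanged.
\<close>

lemma RL_prabhakar:
  assumes p: "p > 0" and \<alpha>: "\<alpha> > 0" and u: "continuous_on {0..x} u" and x: "x \<ge> 0"
  shows "volterra (power_kernel p) (volterra (prabhakar_kernel \<rho> \<omega> \<gamma> \<alpha>) u) x
    = volterra (prabhakar_kernel \<rho> \<omega> \<gamma> (p + \<alpha>)) u x"
proof -
  obtain U where U: "\<And>t. t \<in> {0..x} \<Longrightarrow> \<bar>u t\<bar> \<le> U"
    using compact_imp_bounded[OF compact_continuous_image[OF u compact_Icc]]
    by (force simp: bounded_iff)
  obtain S where S: "S > 0" "\<bar>\<omega>\<bar> * S powr \<rho> < 1" using ex_small_powr[of "\<bar>\<omega>\<bar>" \<rho>] \<rho> by auto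
  obtain C where C: "\<And>p u t U. \<lbrakk>p > 0; t \<in> {0..x}; continuous_on {0..t} u; \<And>s. s \<in> {0..t} \<Longrightarrow> \<bar>u s\<bar> \<le> U\<rbrakk>
      \<Longrightarrow> \<bar>volterra (power_kernel p) u t\<bar> \<le> C * U * S powr p"
    using RL_bound_geometric[OF S(1), of x] by metis
  have pos: "\<rho> * real k + \<alpha> > 0" for k using \<rho> \<alpha> by (simp add: add_nonneg_pos)
  define v where "v k t = prabhakar_coeff \<omega> \<gamma> k * volterra (power_kernel (\<rho> * k + \<alpha>)) u t" for k :: nat and t
  have ut: "continuous_on {0..t} u" if "t \<in> {0..x}" for t using that by (intro continuous_on_subset[OF u]) auto
  have cont: "continuous_on {0..x} (v k)" for k
    unfolding v_def by (rule continuous_on_mult_left[OF continuous_on_volterra[OF power_kernel_integrable[OF pos] u]])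
  have sm: "summable (\<lambda>k. \<bar>pochhammer \<gamma> k / fact k\<bar> * (\<bar>\<omega>\<bar> * S powr \<rho>) ^ k * (C * U * S powr \<alpha>))"
    using S by (intro summable_mult2 summable_abs_pochhammer) auto
  have le: "\<bar>v k t\<bar> \<le> \<bar>pochhammer \<gamma> k / fact k\<bar> * (\<bar>\<omega>\<bar> * S powr \<rho>) ^ k * (C * U * S powr \<alpha>)"
    if t: "t \<in> {0..x}" for k t
  proof -
    have "\<bar>v k t\<bar> \<le> \<bar>prabhakar_coeff \<omega> \<gamma> k\<bar> * (C * U * S powr (\<rho> * k + \<alpha>))"
      unfolding v_def abs_mult using t U by (intro mult_left_mono C[OF pos t ut[OF t]]) auto
    also have "S powr (\<rho> * k + \<alpha>) = (S powr \<rho>) ^ k * S powr \<alpha>"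
      using S by (simp add: powr_add powr_powr flip: powr_realpow)
    finally show ?thesis
      by (simp add: prabhakar_coeff_def abs_mult power_abs power_mult_distrib mult_ac)
  qed
  have "(\<lambda>k. volterra (power_kernel p) (v k) x) sums volterra (power_kernel p) (\<lambda>t. \<Sum>k. v k t) x"
    by (rule volterra_sums(1)[OF power_kernel_integrable[OF p] cont sm le])
  also have "volterra (power_kernel p) (\<lambda>t. \<Sum>k. v k t) x
      = volterra (power_kernel p) (volterra (prabhakar_kernel \<rho> \<omega> \<gamma> \<alpha>) u) x"
  proof (rule volterra_cong)
    fix t assume t: "t \<in> {0..x}"
    show "(\<Sum>k. v k t) = volterra (prabhakar_kernel \<rho> \<omega> \<gamma> \<alpha>) u t"
      unfolding v_def using prabhakar_sums[OF \<alpha> ut[OF t]] t by (intro sums_unique[symmetric]) auto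
  qed
  finally have sums_v: "(\<lambda>k. volterra (power_kernel p) (v k) x) sums
      volterra (power_kernel p) (volterra (prabhakar_kernel \<rho> \<omega> \<gamma> \<alpha>) u) x" .
  have "volterra (power_kernel p) (v k) x
      = prabhakar_coeff \<omega> \<gamma> k * volterra (power_kernel (\<rho> * k + (p + \<alpha>))) u x" for k
    unfolding v_def using RL_semigroup[OF p pos x u, of k]
    by (simp add: volterra_scale[OF power_kernel_integrable[OF p]] add_ac)
  with sums_v show ?thesis
    by (intro sums_unique2[OF _ prabhakar_sums[OF _ u x]]) (use p \<alpha> in auto)
qed

text \<open>
  Expand both operators into Riemann-Liouville integrals. Their orders add, so the term with indices
  \<open>i\<close> and \<open>l\<close> contains the integral of order \<open>\<rho> (i + l) + \<alpha> + \<beta>\<close>; collecting the terms with equal \<open>i + l\<close>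
  reduces the claim to the Chu-Vandermonde identity for the coefficients.
\<close>

lemma prabhakar_semigroup:
  assumes \<alpha>: "\<alpha> > 0" and \<beta>: "\<beta> > 0" and u: "continuous_on {0..x} u" and x: "x \<ge> 0"
  shows "volterra (prabhakar_kernel \<rho> \<omega> \<gamma> \<alpha>) (volterra (prabhakar_kernel \<rho> \<omega> \<delta> \<beta>) u) x
    = volterra (prabhakar_kernel \<rho> \<omega> (\<gamma> + \<delta>) (\<alpha> + \<beta>)) u x"
proof -
  obtain U where U: "\<And>t. t \<in> {0..x} \<Longrightarrow> \<bar>u t\<bar> \<le> U"
    using compact_imp_bounded[OF compact_continuous_image[OF u compact_Icc]]
    by (force simp: bounded_iff)
  have "U \<ge> 0" using U[of 0] x by auto
  obtain S where S: "S > 0" "\<bar>\<omega>\<bar> * S powr \<rho> < 1" using ex_small_powr[of "\<bar>\<omega>\<bar>" \<rho>] \<rho> by auto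
  obtain C where C0: "C \<ge> 0" and
    C: "\<And>p u t U. \<lbrakk>p > 0; t \<in> {0..x}; continuous_on {0..t} u; \<And>s. s \<in> {0..t} \<Longrightarrow> \<bar>u s\<bar> \<le> U\<rbrakk>
      \<Longrightarrow> \<bar>volterra (power_kernel p) u t\<bar> \<le> C * U * S powr p"
    using RL_bound_geometric[OF S(1), of x] by metis
  define f where "f i l = prabhakar_coeff \<omega> \<gamma> i * (prabhakar_coeff \<omega> \<delta> l * 
      volterra (power_kernel (\<rho> * (i + l) + (\<alpha> + \<beta>))) u x)" for i l :: nat
  define D where "D = C * U * S powr (\<alpha> + \<beta>)"
  have D: "D \<ge> 0" using C0 \<open>U \<ge> 0\<close> by (simp add: D_def)
  let ?m = "\<lambda>\<gamma> k. \<bar>pochhammer \<gamma> k / fact k\<bar> * (\<bar>\<omega>\<bar> * S powr \<rho>) ^ k"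
  have sm: "summable (?m \<gamma>)" for \<gamma>
    using S by (intro summable_abs_pochhammer) auto
  have "(\<lambda>k. \<Sum>i\<le>k. f i (k - i)) sums (\<Sum>i. \<Sum>l. f i l)"
  proof (rule double_series_diagonal)
    show "summable (\<lambda>i. ?m \<gamma> i * D)" "summable (?m \<delta>)" by (intro summable_mult2 sm)+
    show "0 \<le> ?m \<gamma> i * D" "0 \<le> ?m \<delta> i" for i using D by auto
    fix i l :: nat
    have pos: "\<rho> * real (i + l) + (\<alpha> + \<beta>) > 0" using \<rho> \<alpha> \<beta> by (simp add: add_nonneg_pos)
    have "\<bar>f i l\<bar> \<le> \<bar>prabhakar_coeff \<omega> \<gamma> i\<bar> * (\<bar>prabhakar_coeff \<omega> \<delta> l\<bar> *
        (C * U * S powr (\<rho> * (i + l) + (\<alpha> + \<beta>))))"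
      unfolding f_def abs_mult using x U by (intro mult_left_mono C[OF pos _ u]) auto
    also have "S powr (\<rho> * (i + l) + (\<alpha> + \<beta>)) = (S powr \<rho>) ^ i * (S powr \<rho>) ^ l * S powr (\<alpha> + \<beta>)"
      using S by (simp add: powr_add powr_powr distrib_left flip: powr_realpow)
    finally show "\<bar>f i l\<bar> \<le> ?m \<gamma> i * D * ?m \<delta> l"
      by (simp add: D_def prabhakar_coeff_def abs_mult power_abs power_mult_distrib mult_ac)
  qed
  moreover have "(\<Sum>i\<le>k. f i (k - i)) = prabhakar_coeff \<omega> (\<gamma> + \<delta>) k *
      volterra (power_kernel (\<rho> * k + (\<alpha> + \<beta>))) u x" for k
    by (simp add: f_def sum_distrib_right mult.assoc flip: prabhakar_coeff_add)
  ultimately have "(\<lambda>k. prabhakar_coeff \<omega> (\<gamma> + \<delta>) k * volterra (power_kernel (\<rho> * k + (\<alpha> + \<beta>))) u x)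
      sums (\<Sum>i. \<Sum>l. f i l)" by simp
  from sums_unique2[OF this prabhakar_sums[OF _ u x]]
  have "volterra (prabhakar_kernel \<rho> \<omega> (\<gamma> + \<delta>) (\<alpha> + \<beta>)) u x = (\<Sum>i. \<Sum>l. f i l)"
    using \<alpha> \<beta> by simp
  moreover have "(\<Sum>l. f i l) = prabhakar_coeff \<omega> \<gamma> i *
      volterra (power_kernel (\<rho> * i + \<alpha>)) (volterra (prabhakar_kernel \<rho> \<omega> \<delta> \<beta>) u) x" for i
  proof -
    have pos: "\<rho> * real i + \<alpha> > 0" using \<rho> \<alpha> by (simp add: add_nonneg_pos)
    have "f i sums (prabhakar_coeff \<omega> \<gamma> i * volterra (prabhakar_kernel \<rho> \<omega> \<delta> (\<rho> * i + \<alpha> + \<beta>)) u x)"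
      using sums_mult[OF prabhakar_sums[OF _ u x, of "\<rho> * i + \<alpha> + \<beta>" \<delta>], of "prabhakar_coeff \<omega> \<gamma> i"] pos \<beta>
      by (simp add: f_def[abs_def] algebra_simps)
    then show ?thesis
      by (simp add: RL_prabhakar[OF pos \<beta> u x] sums_iff)
  qed
  moreover have "(\<Sum>i. prabhakar_coeff \<omega> \<gamma> i *
      volterra (power_kernel (\<rho> * i + \<alpha>)) (volterra (prabhakar_kernel \<rho> \<omega> \<delta> \<beta>) u) x)
      = volterra (prabhakar_kernel \<rho> \<omega> \<gamma> \<alpha>) (volterra (prabhakar_kernel \<rho> \<omega> \<delta> \<beta>) u) x"
    by (rule sums_unique[symmetric, OF prabhakar_sums[OF \<alpha> continuous_on_volterra[OF prabhakar_kernel_integrable[OF \<beta>] u] x]])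
  ultimately show ?thesis by simp
qed

lemma prabhakar_monomial:
  assumes \<alpha>: "\<alpha> > 0" and x: "x \<ge> 0"
  shows "volterra (prabhakar_kernel \<rho> \<omega> \<gamma> \<alpha>) (\<lambda>t. t ^ m) x
    = fact m * (x powr (\<alpha> + m) * mittag_leffler \<gamma> \<rho> (\<alpha> + m + 1) (\<omega> * rpow x \<rho>))"
proof -
  have pos: "\<rho> * real k + \<alpha> > 0" for k using \<rho> \<alpha> by (simp add: add_nonneg_pos)
  have "(\<lambda>k. prabhakar_coeff \<omega> \<gamma> k * volterra (power_kernel (\<rho> * k + \<alpha>)) (\<lambda>t. t ^ m) x)
    sums volterra (prabhakar_kernel \<rho> \<omega> \<gamma> \<alpha>) (\<lambda>t. t ^ m) x"
    by (intro prabhakar_sums continuous_intros \<alpha> x)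
  moreover have "(\<lambda>k. fact m * (x powr (\<alpha> + m) * (pochhammer \<gamma> k / Gamma (\<rho> * k + (\<alpha> + m + 1)) *
      ((\<omega> * rpow x \<rho>) ^ k / fact k))))
    sums (fact m * (x powr (\<alpha> + m) * mittag_leffler \<gamma> \<rho> (\<alpha> + m + 1) (\<omega> * rpow x \<rho>)))"
    unfolding mittag_leffler_def
    by (intro sums_mult summable_sums summable_rabs_cancel[OF mittag_leffler_abs_summable] \<rho>) (use \<alpha> in auto)
  moreover have "prabhakar_coeff \<omega> \<gamma> k * volterra (power_kernel (\<rho> * k + \<alpha>)) (\<lambda>t. t ^ m) x =
      fact m * (x powr (\<alpha> + m) * (pochhammer \<gamma> k / Gamma (\<rho> * k + (\<alpha> + m + 1)) *
      ((\<omega> * rpow x \<rho>) ^ k / fact k)))" for k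
  proof (cases "x = 0")
    case True
    then show ?thesis by (simp add: volterra_def)
  next
    case False
    then have "x powr (\<rho> * k + \<alpha> + m) = x powr (\<alpha> + m) * rpow x \<rho> ^ k"
      using x \<rho> by (simp add: rpow_def powr_add powr_powr flip: powr_realpow)
    then show ?thesis
      unfolding RL_monomial[OF pos x] by (simp add: prabhakar_coeff_def power_mult_distrib add_ac mult_ac)
  qed
  ultimately show ?thesis by (simp add: sums_iff)
qed

text \<open>
  Since the operator of order \<open>\<alpha>\<close> is the ordinary primitive, the Riemann-Liouville integral of order \<open>1\<close>,
  applied to the operator of order \<open>\<alpha> - 1\<close>, this is the fundamental theorem of calculus.
\<close>

lemma prabhakar_has_derivative:
  assumes \<alpha>: "\<alpha> > 1" and u: "continuous_on {0..T} u" and x: "x \<in> {0..T}"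
  shows "(volterra (prabhakar_kernel \<rho> \<omega> \<gamma> \<alpha>) u
    has_real_derivative volterra (prabhakar_kernel \<rho> \<omega> \<gamma> (\<alpha> - 1)) u x) (at x within {0..T})"
proof -
  let ?v = "volterra (prabhakar_kernel \<rho> \<omega> \<gamma> (\<alpha> - 1)) u"
  have v: "continuous_on {0..T} ?v"
    using \<alpha> by (intro continuous_on_volterra[OF prabhakar_kernel_integrable u]) auto
  have "((\<lambda>y. integral {0..y} ?v) has_real_derivative ?v x) (at x within {0..T})"
    by (rule integral_has_real_derivative[OF v x])
  moreover have "volterra (prabhakar_kernel \<rho> \<omega> \<gamma> \<alpha>) u y = integral {0..y} ?v" if y: "y \<in> {0..T}" for y
  proof -
    have "volterra (prabhakar_kernel \<rho> \<omega> \<gamma> \<alpha>) u y = volterra (power_kernel 1) ?v y"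
      using RL_prabhakar[of 1 "\<alpha> - 1" y u \<gamma>] \<alpha> y continuous_on_subset[OF u] by auto
    also have "\<dots> = integral {0..y} ?v"
      unfolding volterra_def by (rule integral_spike[of "{y}"]) (auto simp: power_kernel_def)
    finally show ?thesis .
  qed
  ultimately show ?thesis
    using x by (subst has_field_derivative_cong_eventually[where g="\<lambda>y. integral {0..y} ?v"])
      (auto simp: eventually_at_filter)
qed

end

section \<open>Continuously differentiable functions on an interval\<close>

lemma deriv_Icc_eq:
  assumes "a < b" "x \<in> {a..b}" "(f has_real_derivative D) (at x within {a..b})"
  shows "deriv_Icc a b f x = D"
  unfolding deriv_Icc_def
  by (rule vector_derivative_within_closed_interval[OF assms(1,2)])
     (use assms(3) in \<open>simp add: has_real_derivative_iff_has_vector_derivative\<close>)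

lemma C_Icc_0: "C_Icc 0 a b f \<longleftrightarrow> continuous_on {a..b} f"
  by (simp add: C_Icc_def)

lemma C_Icc_Suc:
  "C_Icc (Suc m) a b f \<longleftrightarrow> f differentiable_on {a..b} \<and> C_Icc m a b (deriv_Icc a b f)"
  by (simp add: C_Icc_def All_less_Suc2 funpow_Suc_right del: funpow.simps)

lemma C_Icc_Suc_has_derivative:
  assumes "C_Icc (Suc m) a b f" "x \<in> {a..b}"
  shows "(f has_real_derivative deriv_Icc a b f x) (at x within {a..b})"
  using assms unfolding C_Icc_Suc differentiable_on_def deriv_Icc_def
  by (simp add: has_real_derivative_iff_has_vector_derivative vector_derivative_works)

text \<open>
  The one-sided derivatives on the interval depend only on the values there.
\<close>

lemma C_Icc_cong:
  assumes "\<And>x. x \<in> {a..b} \<Longrightarrow> f x = g x"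
  shows "C_Icc m a b f \<longleftrightarrow> C_Icc m a b g"
  using assms
proof (induction m arbitrary: f g)
  case 0
  then show ?case unfolding C_Icc_0 by (intro continuous_on_cong) auto
next
  case (Suc m)
  have "deriv_Icc a b f x = deriv_Icc a b g x" if "x \<in> {a..b}" for x
    unfolding deriv_Icc_def using Suc.prems that
    by (intro vector_derivative_cong_eq) (auto intro: always_eventually)
  moreover have "f differentiable_on {a..b} \<longleftrightarrow> g differentiable_on {a..b}"
    using Suc.prems by (auto simp: differentiable_on_def intro: differentiable_transform_within[OF _ zero_less_one])
  ultimately show ?case using Suc.IH[of "deriv_Icc a b f" "deriv_Icc a b g"] by (simp add: C_Icc_Suc)
qed

lemma C_Icc_SucI:
  assumes "a < b" and der: "\<And>x. x \<in> {a..b} \<Longrightarrow> (f has_real_derivative f' x) (at x within {a..b})"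
    and "C_Icc m a b f'"
  shows "C_Icc (Suc m) a b f"
proof -
  have "f differentiable_on {a..b}"
    unfolding differentiable_on_def real_differentiable_def using der by blast
  moreover have "C_Icc m a b (deriv_Icc a b f) \<longleftrightarrow> C_Icc m a b f'"
    by (intro C_Icc_cong deriv_Icc_eq assms)
  ultimately show ?thesis using assms by (simp add: C_Icc_Suc)
qed

lemma C_Icc_SucD: "C_Icc (Suc m) a b f \<Longrightarrow> C_Icc m a b f"
proof (induction m arbitrary: f)
  case 0
  then show ?case by (simp add: C_Icc_Suc C_Icc_0 differentiable_imp_continuous_on)
next
  case (Suc m)
  then show ?case using C_Icc_Suc by blast
qed

lemma C_Icc_imp_continuous_on: "C_Icc m a b f \<Longrightarrow> continuous_on {a..b} f"
  by (induction m) (auto simp: C_Icc_0 dest: C_Icc_SucD)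

lemma C_Icc_const: "a < b \<Longrightarrow> C_Icc m a b (\<lambda>x. r)"
proof (induction m arbitrary: r)
  case (Suc m)
  then show ?case by (intro C_Icc_SucI[of _ _ _ "\<lambda>x. 0"]) auto
qed (simp add: C_Icc_0)

lemma C_Icc_add:
  assumes "a < b" "C_Icc m a b f" "C_Icc m a b g"
  shows "C_Icc m a b (\<lambda>x. f x + g x)"
  using assms(2,3)
proof (induction m arbitrary: f g)
  case 0
  then show ?case by (simp add: C_Icc_0 continuous_on_add)
next
  case (Suc m)
  show ?case
  proof (rule C_Icc_SucI[OF \<open>a < b\<close>])
    show "((\<lambda>x. f x + g x) has_real_derivative deriv_Icc a b f x + deriv_Icc a b g x) (at x within {a..b})"
      if "x \<in> {a..b}" for x
      using Suc.prems that by (intro DERIV_add C_Icc_Suc_has_derivative)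
    show "C_Icc m a b (\<lambda>x. deriv_Icc a b f x + deriv_Icc a b g x)"
      using Suc by (simp add: C_Icc_Suc)
  qed
qed

lemma C_Icc_mult:
  assumes "a < b" "C_Icc m a b f" "C_Icc m a b g"
  shows "C_Icc m a b (\<lambda>x. f x * g x)"
  using assms(2,3)
proof (induction m arbitrary: f g)
  case 0
  then show ?case by (simp add: C_Icc_0 continuous_on_mult)
next
  case (Suc m)
  show ?case
  proof (rule C_Icc_SucI[OF \<open>a < b\<close>])
    show "((\<lambda>x. f x * g x) has_real_derivative deriv_Icc a b f x * g x + deriv_Icc a b g x * f x) (at x within {a..b})"
      if "x \<in> {a..b}" for x
      using Suc.prems that by (intro DERIV_mult C_Icc_Suc_has_derivative)
    show "C_Icc m a b (\<lambda>x. deriv_Icc a b f x * g x + deriv_Icc a b g x * f x)"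
      using Suc.prems C_Icc_SucD[of m] by (intro C_Icc_add Suc.IH assms) (auto simp: C_Icc_Suc)
  qed
qed

lemma C_Icc_power:
  assumes "a < b" "C_Icc m a b f"
  shows "C_Icc m a b (\<lambda>x. f x ^ i)"
  by (induction i) (use assms in \<open>auto intro: C_Icc_const C_Icc_mult\<close>)

lemma C_Icc_sum:
  assumes "a < b" "\<And>i. i \<in> I \<Longrightarrow> C_Icc m a b (f i)"
  shows "C_Icc m a b (\<lambda>x. \<Sum>i\<in>I. f i x)"
  using assms(2)
  by (induction I rule: infinite_finite_induct) (use assms(1) in \<open>auto intro: C_Icc_const C_Icc_add\<close>)

text \<open>
  The difference quotients are nonnegative, also the one-sided ones at the endpoints.
\<close>

lemma mono_on_derivative_nonneg:
  fixes f :: "real \<Rightarrow> real"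
  assumes "a < b" "mono_on {a..b} f" "x \<in> {a..b}" "(f has_real_derivative D) (at x within {a..b})"
  shows "0 \<le> D"
proof (rule tendsto_lowerbound)
  show "((\<lambda>y. (f y - f x) / (y - x)) \<longlongrightarrow> D) (at x within {a..b})"
    using assms(4) by (simp add: has_field_derivative_iff)
  show "at x within {a..b} \<noteq> bot"
    using assms by (simp add: trivial_limit_within islimpt_Icc)
  have "0 \<le> (f y - f x) / (y - x)" if "y \<in> {a..b}" for y
    using that assms(3) mono_onD[OF assms(2), of x y] mono_onD[OF assms(2), of y x]
    by (cases "x \<le> y") (auto intro: divide_nonneg_nonneg divide_nonpos_nonpos)
  then show "\<forall>\<^sub>F y in at x within {a..b}. 0 \<le> (f y - f x) / (y - x)"
    by (auto simp: eventually_at_filter)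
qed

section \<open>Change of the time variable\<close>

text \<open>
  The substitution \<open>s = \<psi> t - \<psi> a\<close> maps \<open>[a,b]\<close> onto an interval starting at \<open>0\<close> and turns the
  integrals with respect to \<open>\<psi>\<close> into convolutions.
\<close>

locale time_change =
  fixes a b :: real and \<psi> \<psi>' :: "real \<Rightarrow> real"
  assumes a_less_b: "a < b"
    and der: "\<And>x. x \<in> {a..b} \<Longrightarrow> (\<psi> has_real_derivative \<psi>' x) (at x within {a..b})"
    and der_pos: "\<And>x. x \<in> {a..b} \<Longrightarrow> 0 < \<psi>' x"
begin

definition \<tau> :: "real \<Rightarrow> real" where "\<tau> x = \<psi> x - \<psi> a"

lemma \<tau>_der: "x \<in> {a..b} \<Longrightarrow> (\<tau> has_real_derivative \<psi>' x) (at x within {a..b})"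
  unfolding \<tau>_def[abs_def] using der by (auto intro!: derivative_eq_intros)

lemma \<tau>_continuous: "continuous_on {a..b} \<tau>"
  using \<tau>_der by (rule DERIV_continuous_on)

lemma \<tau>_strict_mono:
  assumes "x \<in> {a..b}" "y \<in> {a..b}" "x < y"
  shows "\<tau> x < \<tau> y"
proof -
  have "\<exists>z\<in>{x<..<y}. \<tau> y - \<tau> x = (y - x) * \<psi>' z"
  proof (rule mvt_simple[OF assms(3), of \<tau> "\<lambda>z h. h * \<psi>' z"])
    fix z assume "x \<le> z" "z \<le> y"
    then have "(\<tau> has_real_derivative \<psi>' z) (at z within {x..y})"
      using assms by (intro DERIV_subset[OF \<tau>_der]) auto
    then show "(\<tau> has_derivative (\<lambda>h. h * \<psi>' z)) (at z within {x..y})"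
      by (simp add: has_field_derivative_def mult_commute_abs)
  qed
  then obtain z where "z \<in> {x<..<y}" "\<tau> y - \<tau> x = (y - x) * \<psi>' z" by auto
  moreover have "(y - x) * \<psi>' z > 0"
    using der_pos[of z] assms \<open>z \<in> {x<..<y}\<close> by auto
  ultimately show ?thesis by linarith
qed

lemma \<tau>_inj: "inj_on \<tau> {a..b}"
  using \<tau>_strict_mono by (metis inj_onI linorder_less_linear less_irrefl)

lemma \<tau>_image:
  assumes x: "x \<in> {a..b}"
  shows "\<tau> ` {a..x} = {0..\<tau> x}"
proof
  have "\<tau> a = 0" by (simp add: \<tau>_def)
  show "\<tau> ` {a..x} \<subseteq> {0..\<tau> x}"
  proof safe
    fix t assume "t \<in> {a..x}"
    then show "\<tau> t \<in> {0..\<tau> x}"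
      using \<tau>_strict_mono[of a t] \<tau>_strict_mono[of t x] x \<open>\<tau> a = 0\<close>
      by (cases "a = t"; cases "t = x") auto
  qed
  show "{0..\<tau> x} \<subseteq> \<tau> ` {a..x}"
  proof
    fix s assume "s \<in> {0..\<tau> x}"
    then have "\<exists>t. a \<le> t \<and> t \<le> x \<and> \<tau> t = s"
      using x \<open>\<tau> a = 0\<close> by (intro IVT' continuous_on_subset[OF \<tau>_continuous]) auto
    then show "s \<in> \<tau> ` {a..x}" by auto
  qed
qed

lemma \<tau>_mem: "x \<in> {a..b} \<Longrightarrow> \<tau> x \<in> {0..\<tau> b}"
  using \<tau>_image[of b] a_less_b by auto

lemma integral_substitution:
  assumes x: "x \<in> {a..b}" and h: "h absolutely_integrable_on {0..\<tau> x}"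
  shows "integral {a..x} (\<lambda>t. \<psi>' t * h (\<tau> t)) = integral {0..\<tau> x} h"
proof -
  have sub: "{a..x} \<subseteq> {a..b}" using x by auto
  have "(\<lambda>t. \<bar>\<psi>' t\<bar> * h (\<tau> t)) absolutely_integrable_on {a..x} \<and>
      integral {a..x} (\<lambda>t. \<bar>\<psi>' t\<bar> * h (\<tau> t)) = integral (\<tau> ` {a..x}) h \<longleftrightarrow>
      h absolutely_integrable_on \<tau> ` {a..x} \<and> integral (\<tau> ` {a..x}) h = integral (\<tau> ` {a..x}) h"
    by (rule has_absolute_integral_change_of_variables_1')
       (use sub in \<open>auto intro: DERIV_subset[OF \<tau>_der] inj_on_subset[OF \<tau>_inj]\<close>)
  then have "integral {a..x} (\<lambda>t. \<bar>\<psi>' t\<bar> * h (\<tau> t)) = integral {0..\<tau> x} h"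
    using h by (simp add: \<tau>_image[OF x])
  also have "integral {a..x} (\<lambda>t. \<bar>\<psi>' t\<bar> * h (\<tau> t)) = integral {a..x} (\<lambda>t. \<psi>' t * h (\<tau> t))"
    using der_pos sub by (intro integral_cong) (force simp: abs_of_pos)
  finally show ?thesis .
qed

lemma prabhakar_int_eq:
  assumes "\<rho> > 0" "\<alpha> > 0" and x: "x \<in> {a..b}" and v: "continuous_on {0..\<tau> b} v"
    and u: "\<And>t. t \<in> {a..b} \<Longrightarrow> u t = v (\<tau> t)"
  shows "prabhakar_int a b \<psi> \<gamma> \<rho> \<alpha> \<omega> u x = volterra (prabhakar_kernel \<rho> \<omega> \<gamma> \<alpha>) v (\<tau> x)"
proof -
  let ?k = "prabhakar_kernel \<rho> \<omega> \<gamma> \<alpha>"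
  have "prabhakar_int a b \<psi> \<gamma> \<rho> \<alpha> \<omega> u x = integral {a..x} (\<lambda>t. \<psi>' t * (?k (\<tau> x - \<tau> t) * v (\<tau> t)))"
    unfolding prabhakar_int_def
  proof (rule integral_cong)
    fix t assume "t \<in> {a..x}"
    then have t: "t \<in> {a..b}" using x by auto
    show "deriv_Icc a b \<psi> t * rpow (\<psi> x - \<psi> t) (\<alpha> - 1) * mittag_leffler \<gamma> \<rho> \<alpha> (\<omega> * rpow (\<psi> x - \<psi> t) \<rho>) * u t
        = \<psi>' t * (?k (\<tau> x - \<tau> t) * v (\<tau> t))"
      using u[OF t] deriv_Icc_eq[OF a_less_b t der[OF t]] by (simp add: prabhakar_kernel_def \<tau>_def)
  qed
  also have "\<dots> = integral {0..\<tau> x} (\<lambda>s. ?k (\<tau> x - s) * v s)"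
    using \<tau>_mem[OF x] assms
    by (intro integral_substitution[OF x] volterra_integrable prabhakar_kernel_integrable
        continuous_on_subset[OF v]) auto
  finally show ?thesis by (simp add: volterra_def)
qed

text \<open>
  Each differentiation lowers the order by \<open>1\<close> and produces a factor \<open>\<psi>'\<close>, which has one derivative less than \<open>\<psi>\<close>.
  This can be repeated as long as the order stays positive.
\<close>

lemma C_Icc_prabhakar:
  assumes "\<rho> > 0" "\<alpha> > real m" "C_Icc m a b \<psi>" and v: "continuous_on {0..\<tau> b} v"
  shows "C_Icc m a b (\<lambda>x. volterra (prabhakar_kernel \<rho> \<omega> \<gamma> \<alpha>) v (\<tau> x))"
  using assms(2,3)
proof (induction m arbitrary: \<alpha>)
  case 0
  have "continuous_on {0..\<tau> b} (volterra (prabhakar_kernel \<rho> \<omega> \<gamma> \<alpha>) v)"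
    using 0 assms by (intro continuous_on_volterra[OF prabhakar_kernel_integrable v]) auto
  from continuous_on_compose2[OF this \<tau>_continuous] show ?case
    unfolding C_Icc_0 using \<tau>_mem by blast
next
  case (Suc m)
  let ?I = "\<lambda>\<alpha>. volterra (prabhakar_kernel \<rho> \<omega> \<gamma> \<alpha>) v"
  show ?case
  proof (rule C_Icc_SucI[OF a_less_b])
    fix x assume x: "x \<in> {a..b}"
    have im: "\<tau> ` {a..b} = {0..\<tau> b}" using \<tau>_image[of b] a_less_b by auto
    have "(?I \<alpha> \<circ> \<tau> has_real_derivative ?I (\<alpha> - 1) (\<tau> x) * \<psi>' x) (at x within {a..b})"
      by (rule DERIV_image_chain[OF _ \<tau>_der[OF x]], unfold im)
         (use assms(1) Suc.prems(1) \<tau>_mem[OF x] in \<open>auto intro: prabhakar_has_derivative[OF _ _ v]\<close>)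
    then show "((\<lambda>x. ?I \<alpha> (\<tau> x)) has_real_derivative ?I (\<alpha> - 1) (\<tau> x) * deriv_Icc a b \<psi> x) (at x within {a..b})"
      by (simp add: o_def deriv_Icc_eq[OF a_less_b x der[OF x]])
  next
    show "C_Icc m a b (\<lambda>x. ?I (\<alpha> - 1) (\<tau> x) * deriv_Icc a b \<psi> x)"
      using Suc.prems C_Icc_SucD by (intro C_Icc_mult a_less_b Suc.IH) (auto simp: C_Icc_Suc)
  qed
qed

end

section \<open>The reduced Volterra equation\<close>

text \<open>
  With upper parameter \<open>0\<close> only the first term of the series is left, so the operators with
  \<open>\<gamma> = 0\<close> are the Riemann-Liouville integrals.
\<close>

lemma mittag_leffler_0: "mittag_leffler 0 \<rho> \<alpha> z = 1 / Gamma \<alpha>"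
  unfolding mittag_leffler_def by (subst suminf_finite[of "{0}"]) (auto simp: pochhammer_0_left)

text \<open>
  These are the \<open>j\<close>-th iterates of the Prabhakar integral on \<open>x ^ i / fact i\<close>. The power of \<open>x\<close> is split
  so that \<open>x ^ i\<close> can later be taken out of the sum over \<open>j\<close>.
\<close>

definition monomial_resolvent :: "real \<Rightarrow> real \<Rightarrow> real \<Rightarrow> real \<Rightarrow> nat \<Rightarrow> nat \<Rightarrow> real \<Rightarrow> real" where
  "monomial_resolvent \<rho> \<omega> \<gamma> \<delta> i j x = x ^ i * (rpow x (real j * \<delta>) *
     mittag_leffler (real j * \<gamma>) \<rho> (real j * \<delta> + real i + 1) (\<omega> * rpow x \<rho>))"

lemma monomial_resolvent_0: "monomial_resolvent \<rho> \<omega> \<gamma> \<delta> i 0 x = x ^ i / fact i"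
  using Gamma_fact[of i, where 'a = real]
  by (simp add: monomial_resolvent_def rpow_def mittag_leffler_0 add.commute)

text \<open>
  By the semigroup law the iterates are single Prabhakar integrals, which are known on monomials. The
  case \<open>j = 0\<close> is separate because the identity is not given by an integrable kernel.
\<close>

lemma monomial_resolvent_Suc:
  assumes \<rho>: "\<rho> > 0" and \<delta>: "\<delta> > 0" and x: "x \<ge> 0"
  shows "monomial_resolvent \<rho> \<omega> \<gamma> \<delta> i (Suc j) x
    = volterra (prabhakar_kernel \<rho> \<omega> \<gamma> \<delta>) (monomial_resolvent \<rho> \<omega> \<gamma> \<delta> i j) x"
proof -
  let ?K = "\<lambda>\<gamma> \<delta>. volterra (prabhakar_kernel \<rho> \<omega> \<gamma> \<delta>)"
  have closed: "monomial_resolvent \<rho> \<omega> \<gamma> \<delta> i (Suc j) t = ?K (Suc j * \<gamma>) (Suc j * \<delta>) (\<lambda>t. 1 / fact i * t ^ i) t"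
    if t: "t \<ge> 0" for j t
  proof -
    have pos: "real (Suc j) * \<delta> > 0" using \<delta> by simp
    have "t powr (Suc j * \<delta> + i) = t ^ i * rpow t (Suc j * \<delta>)"
    proof (cases "t = 0")
      case False
      then have "t powr real i = t ^ i" using t by (simp add: powr_realpow)
      then show ?thesis using pos False by (simp add: rpow_def powr_add del: of_nat_Suc)
    qed (use pos \<delta> in \<open>simp add: rpow_def\<close>)
    then show ?thesis
      unfolding monomial_resolvent_def
        volterra_scale[OF prabhakar_kernel_integrable[OF \<rho> pos]] prabhakar_monomial[OF \<rho> pos t]
      by (simp del: of_nat_Suc)
  qed
  show ?thesis
  proof (cases j)
    case 0
    then show ?thesis
      unfolding closed[OF x] by (simp add: monomial_resolvent_0[abs_def])
  next
    case (Suc j')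
    have "monomial_resolvent \<rho> \<omega> \<gamma> \<delta> i (Suc j) x
        = ?K (\<gamma> + j * \<gamma>) (\<delta> + j * \<delta>) (\<lambda>t. 1 / fact i * t ^ i) x"
      unfolding closed[OF x] by (simp add: algebra_simps)
    also have "\<dots> = ?K \<gamma> \<delta> (?K (j * \<gamma>) (j * \<delta>) (\<lambda>t. 1 / fact i * t ^ i)) x"
      using Suc \<delta> x by (intro prabhakar_semigroup[OF \<rho>, symmetric] continuous_intros) auto
    also have "\<dots> = ?K \<gamma> \<delta> (monomial_resolvent \<rho> \<omega> \<gamma> \<delta> i j) x"
      using closed[of _ j'] Suc by (intro volterra_cong) auto
    finally show ?thesis .
  qed
qed

lemma prabhakar_resolvent_Suc:
  assumes \<rho>: "\<rho> > 0" and \<delta>: "\<delta> > 0" and \<beta>: "\<beta> > 0" and x: "x \<ge> 0" and g: "continuous_on {0..x} g"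
  shows "volterra (prabhakar_kernel \<rho> \<omega> (real (Suc j) * \<gamma>) (real (Suc j) * \<delta> + \<beta>)) g x
    = volterra (prabhakar_kernel \<rho> \<omega> \<gamma> \<delta>)
        (volterra (prabhakar_kernel \<rho> \<omega> (real j * \<gamma>) (real j * \<delta> + \<beta>)) g) x"
proof -
  have "real j * \<delta> + \<beta> > 0" using \<delta> \<beta> by (simp add: add_nonneg_pos)
  from prabhakar_semigroup[OF \<rho> \<delta> this g x, of \<omega> \<gamma> "real j * \<gamma>"] show ?thesis
    by (simp add: algebra_simps)
qed

text \<open>
  The equation in the variable \<open>\<psi> x - \<psi> a\<close>. The inhomogeneous part is a sum of monomials and of one
  Prabhakar integral. The iterates of each of them are known, so the solution is assembled linearly from
  their Neumann series.
\<close>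

lemma prabhakar_volterra_equation:
  fixes c :: "nat \<Rightarrow> real" and T lam \<rho> \<omega> \<gamma> \<delta> \<beta> :: real and n :: nat and g :: "real \<Rightarrow> real"
  assumes \<rho>: "\<rho> > 0" and \<delta>: "\<delta> > 0" and \<beta>: "\<beta> > 0" and g: "continuous_on {0..T} g"
  defines "K \<equiv> volterra (prabhakar_kernel \<rho> \<omega> \<gamma> \<delta>)"
    and "W \<equiv> monomial_resolvent \<rho> \<omega> \<gamma> \<delta>"
    and "F \<equiv> \<lambda>j. volterra (prabhakar_kernel \<rho> \<omega> (real j * \<gamma>) (real j * \<delta> + \<beta>)) g"
  defines "V \<equiv> \<lambda>x. (\<Sum>i<n. c i * (\<Sum>j. lam ^ j * W i j x)) + (\<Sum>j. lam ^ j * F j x)"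
  shows "\<And>i x. x \<in> {0..T} \<Longrightarrow> summable (\<lambda>j. lam ^ j * W i j x)"
    and "\<And>x. x \<in> {0..T} \<Longrightarrow> summable (\<lambda>j. lam ^ j * F j x)"
    and "continuous_on {0..T} V"
    and "\<And>x. x \<in> {0..T} \<Longrightarrow> V x = (\<Sum>i<n. c i * (x ^ i / fact i)) + lam * K V x + F 0 x"
    and "\<And>v x. \<lbrakk>continuous_on {0..T} v;
        \<And>x. x \<in> {0..T} \<Longrightarrow> v x = (\<Sum>i<n. c i * (x ^ i / fact i)) + lam * K v x + F 0 x; x \<in> {0..T}\<rbrakk>
      \<Longrightarrow> v x = V x"
proof -
  note k = prabhakar_kernel_integrable[OF \<rho> \<delta>, where \<omega> = \<omega> and \<gamma> = \<gamma>]
  have W0: "continuous_on {0..T} (W i 0)" for i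
    unfolding W_def monomial_resolvent_0[abs_def] by (intro continuous_intros) auto
  have WS: "W i (Suc j) x = volterra (prabhakar_kernel \<rho> \<omega> \<gamma> \<delta>) (W i j) x" if "x \<in> {0..T}" for i j x
    unfolding W_def using that by (intro monomial_resolvent_Suc \<rho> \<delta>) auto
  have F0: "continuous_on {0..T} (F 0)"
    unfolding F_def using \<beta> by (intro continuous_on_volterra[OF prabhakar_kernel_integrable[OF \<rho>] g]) auto
  have FS: "F (Suc j) x = volterra (prabhakar_kernel \<rho> \<omega> \<gamma> \<delta>) (F j) x" if "x \<in> {0..T}" for j x
    unfolding F_def using that by (intro prabhakar_resolvent_Suc \<rho> \<delta> \<beta> continuous_on_subset[OF g]) auto
  have NW: "\<And>i x. x \<in> {0..T} \<Longrightarrow> summable (\<lambda>j. lam ^ j * W i j x)"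
    "\<And>i. continuous_on {0..T} (\<lambda>x. \<Sum>j. lam ^ j * W i j x)"
    "\<And>i x. x \<in> {0..T} \<Longrightarrow> (\<Sum>j. lam ^ j * W i j x) = W i 0 x + lam * K (\<lambda>x. \<Sum>j. lam ^ j * W i j x) x"
    unfolding K_def by (rule neumann_series[OF k W0 WS]; assumption)+
  have NF: "\<And>x. x \<in> {0..T} \<Longrightarrow> summable (\<lambda>j. lam ^ j * F j x)"
    "continuous_on {0..T} (\<lambda>x. \<Sum>j. lam ^ j * F j x)"
    "\<And>x. x \<in> {0..T} \<Longrightarrow> (\<Sum>j. lam ^ j * F j x) = F 0 x + lam * K (\<lambda>x. \<Sum>j. lam ^ j * F j x) x"
    unfolding K_def by (rule neumann_series[OF k F0 FS]; assumption)+
  show "summable (\<lambda>j. lam ^ j * W i j x)" if "x \<in> {0..T}" for i x by (rule NW(1)[OF that])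
  show "summable (\<lambda>j. lam ^ j * F j x)" if "x \<in> {0..T}" for x by (rule NF(1)[OF that])
  show contV: "continuous_on {0..T} V"
    unfolding V_def by (intro continuous_on_add continuous_on_sum continuous_on_mult_left NW(2) NF(2))
  have sub: "continuous_on {0..x} w" if "continuous_on {0..T} w" "x \<in> {0..T}" for x and w :: "real \<Rightarrow> real"
    using that by (auto intro: continuous_on_subset)
  show V_eq: "V x = (\<Sum>i<n. c i * (x ^ i / fact i)) + lam * K V x + F 0 x" if x: "x \<in> {0..T}" for x
  proof -
    have "K V x = (\<Sum>i<n. c i * K (\<lambda>x. \<Sum>j. lam ^ j * W i j x) x) + K (\<lambda>x. \<Sum>j. lam ^ j * F j x) x"
      unfolding V_def K_def
      by (simp add: volterra_add[OF k] volterra_sum[OF k] volterra_scale[OF k] continuous_on_sum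
          continuous_on_mult_left sub[OF NW(2) x] sub[OF NF(2) x])
    moreover have "V x = (\<Sum>i<n. c i * (W i 0 x + lam * K (\<lambda>x. \<Sum>j. lam ^ j * W i j x) x))
        + (F 0 x + lam * K (\<lambda>x. \<Sum>j. lam ^ j * F j x) x)"
      unfolding V_def NW(3)[OF x] NF(3)[OF x] ..
    ultimately show ?thesis
      by (simp add: W_def monomial_resolvent_0 algebra_simps sum.distrib sum_distrib_left)
  qed
  show "v x = V x" if v: "continuous_on {0..T} v"
    and eq: "\<And>x. x \<in> {0..T} \<Longrightarrow> v x = (\<Sum>i<n. c i * (x ^ i / fact i)) + lam * K v x + F 0 x"
    and x: "x \<in> {0..T}" for v x
  proof -
    have "v x - V x = 0"
    proof (rule volterra_homogeneous_unique[OF k continuous_on_diff[OF v contV] _ x])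
      fix y assume y: "y \<in> {0..T}"
      show "v y - V y = lam * volterra (prabhakar_kernel \<rho> \<omega> \<gamma> \<delta>) (\<lambda>t. v t - V t) y"
        unfolding volterra_diff[OF k sub[OF v y] sub[OF contV y]]
        using eq[OF y] V_eq[OF y] by (simp add: K_def algebra_simps)
    qed
    then show ?thesis by simp
  qed
qed

section \<open>The equation with respect to an increasing function\<close>

theorem theorem6:
  fixes a b \<alpha> \<beta> \<gamma> \<rho> lam \<omega> :: real
    and n :: nat
    and c :: "nat \<Rightarrow> real"
    and \<psi> f :: "real \<Rightarrow> real"
    and is_solution :: "(real \<Rightarrow> real) \<Rightarrow> bool"
  assumes "0 < a" and "a < b"
    and "\<alpha> > 0" and "\<beta> > 0" and "\<beta> \<notin> \<nat>" and "\<rho> > 0"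
    and "n = nat \<lfloor>\<beta>\<rfloor> + 1"
    and "C_Icc n a b \<psi>" and "mono_on {a..b} \<psi>"
    and "\<forall>x\<in>{a..b}. deriv_Icc a b \<psi> x \<noteq> 0"
    and "continuous_on {a..b} f"
  defines "is_solution \<equiv> (\<lambda>u. C_Icc (n - 1) a b u \<and>
    (\<forall>x\<in>{a..b}. u x =
        (\<Sum>i<n. c i * ((\<psi> x - \<psi> a) ^ i / fact i))
      + lam * integral {a..x} (\<lambda>t. deriv_Icc a b \<psi> t * rpow (\<psi> x - \<psi> t) (\<alpha> + \<beta> - 1)
          * mittag_leffler \<gamma> \<rho> (\<alpha> + \<beta>) (\<omega> * rpow (\<psi> x - \<psi> t) \<rho>) * u t)
      + 1 / Gamma \<beta> * integral {a..x} (\<lambda>t. deriv_Icc a b \<psi> t * rpow (\<psi> x - \<psi> t) (\<beta> - 1) * f t)))"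
  shows "(\<exists>u. is_solution u) \<and>
    (\<forall>u. is_solution u \<longrightarrow> (\<forall>x\<in>{a..b}.
      (\<forall>i<n. summable (\<lambda>j. lam ^ j * rpow (\<psi> x - \<psi> a) (real j * (\<alpha> + \<beta>))
          * mittag_leffler (real j * \<gamma>) \<rho> (real j * (\<alpha> + \<beta>) + real i + 1)
              (\<omega> * rpow (\<psi> x - \<psi> a) \<rho>))) \<and>
      summable (\<lambda>j. lam ^ j
          * prabhakar_int a b \<psi> (real j * \<gamma>) \<rho> (real j * (\<alpha> + \<beta>) + \<beta>) \<omega> f x) \<and>
      u x =
        (\<Sum>i<n. c i * (\<psi> x - \<psi> a) ^ i
          * (\<Sum>j. lam ^ j * rpow (\<psi> x - \<psi> a) (real j * (\<alpha> + \<beta>))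
              * mittag_leffler (real j * \<gamma>) \<rho> (real j * (\<alpha> + \<beta>) + real i + 1)
                  (\<omega> * rpow (\<psi> x - \<psi> a) \<rho>)))
      + (\<Sum>j. lam ^ j
          * prabhakar_int a b \<psi> (real j * \<gamma>) \<rho> (real j * (\<alpha> + \<beta>) + \<beta>) \<omega> f x)))"
proof -
  note a_less_b = assms(2) and \<alpha> = assms(3) and \<beta> = assms(4) and \<rho> = assms(6)
  define \<delta> where "\<delta> = \<alpha> + \<beta>"
  have \<delta>: "\<delta> > 0" using \<alpha> \<beta> by (simp add: \<delta>_def)
  define m where "m = nat \<lfloor>\<beta>\<rfloor>"
  have n: "n = Suc m" using assms(7) by (simp add: m_def)
  \<comment> \<open>The solution has \<open>n - 1 = m\<close> derivatives because the order of the source integral exceeds \<open>m\<close>; here \<open>\<beta>\<close> must not be an integer.\<close>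
  have m_less: "real m < \<beta>"
  proof -
    have "real m \<le> \<beta>" using \<beta> by (simp add: m_def)
    moreover have "real m \<noteq> \<beta>" using assms(5) by (metis of_nat_in_Nats)
    ultimately show ?thesis by simp
  qed
  have \<psi>: "C_Icc (Suc m) a b \<psi>" using assms(8) by (simp add: n)
  interpret time_change a b \<psi> "deriv_Icc a b \<psi>"
  proof
    show "a < b" by (rule a_less_b)
    fix x assume x: "x \<in> {a..b}"
    show der: "(\<psi> has_real_derivative deriv_Icc a b \<psi> x) (at x within {a..b})"
      by (rule C_Icc_Suc_has_derivative[OF \<psi> x])
    show "0 < deriv_Icc a b \<psi> x"
      using mono_on_derivative_nonneg[OF a_less_b assms(9) x der] assms(10) x by force
  qed
  \<comment> \<open>Functions on \<open>[a,b]\<close> and on \<open>[0,T]\<close> correspond to each other through \<open>\<tau>\<close> and its inverse \<open>\<phi>\<close>.\<close>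
  define T where "T = \<tau> b"
  have image_\<tau>: "\<tau> ` {a..b} = {0..T}" using \<tau>_image[of b] a_less_b by (simp add: T_def)
  define \<phi> where "\<phi> = the_inv_into {a..b} \<tau>"
  have \<phi>\<tau>: "\<phi> (\<tau> x) = x" if "x \<in> {a..b}" for x
    unfolding \<phi>_def by (rule the_inv_into_f_f[OF \<tau>_inj that])
  have \<phi>_cont: "continuous_on {0..T} \<phi>"
    using continuous_on_inv_into[OF \<tau>_continuous compact_Icc \<tau>_inj] by (simp add: \<phi>_def image_\<tau>)
  have \<phi>_im: "\<phi> ` {0..T} \<subseteq> {a..b}" unfolding image_\<tau>[symmetric] using \<phi>\<tau> by auto
  define g where "g = (\<lambda>s. f (\<phi> s))"
  have g: "continuous_on {0..T} g"
    unfolding g_def by (rule continuous_on_compose2[OF assms(11) \<phi>_cont \<phi>_im])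
  have fg: "f t = g (\<tau> t)" if "t \<in> {a..b}" for t using \<phi>\<tau>[OF that] by (simp add: g_def)

  define K where "K = volterra (prabhakar_kernel \<rho> \<omega> \<gamma> \<delta>)"
  define W where "W = monomial_resolvent \<rho> \<omega> \<gamma> \<delta>"
  define F where "F = (\<lambda>j::nat. volterra (prabhakar_kernel \<rho> \<omega> (real j * \<gamma>) (real j * \<delta> + \<beta>)) g)"
  define V where "V = (\<lambda>x. (\<Sum>i<n. c i * (\<Sum>j. lam ^ j * W i j x)) + (\<Sum>j. lam ^ j * F j x))"
  note equation = prabhakar_volterra_equation[OF \<rho> \<delta> \<beta> g]
  have W_summable: "\<And>i x. x \<in> {0..T} \<Longrightarrow> summable (\<lambda>j. lam ^ j * W i j x)"
    unfolding W_def by (rule equation(1))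
  have F_summable: "\<And>x. x \<in> {0..T} \<Longrightarrow> summable (\<lambda>j. lam ^ j * F j x)"
    unfolding F_def by (rule equation(2))
  have V_cont: "continuous_on {0..T} V"
    unfolding V_def W_def F_def by (rule equation(3))
  have V_eq: "\<And>x. x \<in> {0..T} \<Longrightarrow> V x = (\<Sum>i<n. c i * (x ^ i / fact i)) + lam * K V x + F 0 x"
    unfolding V_def W_def F_def K_def by (rule equation(4))
  have V_unique: "v x = V x" if "continuous_on {0..T} v" "x \<in> {0..T}"
    "\<And>x. x \<in> {0..T} \<Longrightarrow> v x = (\<Sum>i<n. c i * (x ^ i / fact i)) + lam * K v x + F 0 x" for v x
    unfolding V_def W_def F_def
    by (rule equation(5)) (use that in \<open>simp_all only: K_def F_def\<close>)
  have F_eq: "prabhakar_int a b \<psi> (real j * \<gamma>) \<rho> (real j * \<delta> + \<beta>) \<omega> f x = F j (\<tau> x)"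
    if "x \<in> {a..b}" for j x
    unfolding F_def using \<delta> \<beta> that g fg
    by (intro prabhakar_int_eq \<rho>) (auto simp: T_def intro: add_nonneg_pos)
  have source: "1 / Gamma \<beta> * integral {a..x} (\<lambda>t. deriv_Icc a b \<psi> t * rpow (\<psi> x - \<psi> t) (\<beta> - 1) * f t) = F 0 (\<tau> x)"
    if "x \<in> {a..b}" for x
  proof -
    have "F 0 (\<tau> x) = prabhakar_int a b \<psi> 0 \<rho> \<beta> \<omega> f x" using F_eq[OF that, of 0] by simp
    also have "\<dots> = integral {a..x} (\<lambda>t. 1 / Gamma \<beta> * (deriv_Icc a b \<psi> t * rpow (\<psi> x - \<psi> t) (\<beta> - 1) * f t))"
      unfolding prabhakar_int_def mittag_leffler_0 by (simp add: mult_ac)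
    finally show ?thesis by (simp only: integral_mult_right)
  qed
  have rhs: "(\<Sum>i<n. c i * ((\<psi> x - \<psi> a) ^ i / fact i))
      + lam * integral {a..x} (\<lambda>t. deriv_Icc a b \<psi> t * rpow (\<psi> x - \<psi> t) (\<alpha> + \<beta> - 1)
          * mittag_leffler \<gamma> \<rho> (\<alpha> + \<beta>) (\<omega> * rpow (\<psi> x - \<psi> t) \<rho>) * u t)
      + 1 / Gamma \<beta> * integral {a..x} (\<lambda>t. deriv_Icc a b \<psi> t * rpow (\<psi> x - \<psi> t) (\<beta> - 1) * f t)
    = (\<Sum>i<n. c i * (\<tau> x ^ i / fact i)) + lam * K v (\<tau> x) + F 0 (\<tau> x)"
    if "x \<in> {a..b}" "continuous_on {0..T} v" "\<And>t. t \<in> {a..b} \<Longrightarrow> u t = v (\<tau> t)" for u v x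
  proof -
    have "prabhakar_int a b \<psi> \<gamma> \<rho> \<delta> \<omega> u x = K v (\<tau> x)"
      unfolding K_def using that by (intro prabhakar_int_eq \<rho> \<delta>) (auto simp: T_def)
    then show ?thesis
      unfolding source[OF that(1)] by (simp add: prabhakar_int_def \<delta>_def \<tau>_def)
  qed

  have "is_solution (\<lambda>x. V (\<tau> x))"
    unfolding is_solution_def
  proof (intro conjI ballI)
    \<comment> \<open>Smoothness is read off from the equation, whose right-hand side is smoother than \<open>V\<close> is known to be.\<close>
    have "C_Icc m a b (\<lambda>x. (\<Sum>i<n. (c i / fact i) * (\<psi> x + - \<psi> a) ^ i) + lam * K V (\<tau> x) + F 0 (\<tau> x))"
      unfolding K_def F_def
      using C_Icc_SucD[OF \<psi>] m_less \<alpha> V_cont g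
      by (intro C_Icc_add C_Icc_mult C_Icc_power C_Icc_sum C_Icc_const C_Icc_prabhakar a_less_b \<rho>)
         (auto simp: \<delta>_def T_def)
    also have "?this \<longleftrightarrow> C_Icc (n - 1) a b (\<lambda>x. V (\<tau> x))"
      unfolding diff_Suc_1[of m, folded n] using V_eq[OF \<tau>_mem[folded T_def]]
      by (intro C_Icc_cong) (simp add: \<tau>_def)
    finally show "C_Icc (n - 1) a b (\<lambda>x. V (\<tau> x))" .
  next
    fix x assume x: "x \<in> {a..b}"
    show "V (\<tau> x) = (\<Sum>i<n. c i * ((\<psi> x - \<psi> a) ^ i / fact i))
      + lam * integral {a..x} (\<lambda>t. deriv_Icc a b \<psi> t * rpow (\<psi> x - \<psi> t) (\<alpha> + \<beta> - 1)
          * mittag_leffler \<gamma> \<rho> (\<alpha> + \<beta>) (\<omega> * rpow (\<psi> x - \<psi> t) \<rho>) * V (\<tau> t))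
      + 1 / Gamma \<beta> * integral {a..x} (\<lambda>t. deriv_Icc a b \<psi> t * rpow (\<psi> x - \<psi> t) (\<beta> - 1) * f t)"
      unfolding rhs[OF x V_cont refl] using V_eq[OF \<tau>_mem[OF x, folded T_def]] .
  qed
  moreover have "u x = V (\<tau> x)" if u: "is_solution u" and x: "x \<in> {a..b}" for u x
  proof -
    have "continuous_on {a..b} u" using u C_Icc_imp_continuous_on by (auto simp: is_solution_def)
    then have v: "continuous_on {0..T} (\<lambda>s. u (\<phi> s))"
      by (rule continuous_on_compose2[OF _ \<phi>_cont \<phi>_im])
    have "u (\<phi> (\<tau> x)) = V (\<tau> x)"
    proof (rule V_unique[OF v])
      show "\<tau> x \<in> {0..T}" using \<tau>_mem[OF x] by (simp add: T_def)
      fix s assume "s \<in> {0..T}"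
      then obtain y where y: "y \<in> {a..b}" "s = \<tau> y" unfolding image_\<tau>[symmetric] by auto
      have "u t = u (\<phi> (\<tau> t))" if "t \<in> {a..b}" for t using \<phi>\<tau>[OF that] by simp
      from rhs[OF y(1) v this] u y show "u (\<phi> s) = (\<Sum>i<n. c i * (s ^ i / fact i)) + lam * K (\<lambda>s. u (\<phi> s)) s + F 0 s"
        by (simp add: is_solution_def \<phi>\<tau>)
    qed
    then show ?thesis using \<phi>\<tau>[OF x] by simp
  qed
  moreover have "(\<forall>i<n. summable (\<lambda>j. lam ^ j * rpow (\<psi> x - \<psi> a) (real j * (\<alpha> + \<beta>))
          * mittag_leffler (real j * \<gamma>) \<rho> (real j * (\<alpha> + \<beta>) + real i + 1) (\<omega> * rpow (\<psi> x - \<psi> a) \<rho>))) \<and>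
      summable (\<lambda>j. lam ^ j * prabhakar_int a b \<psi> (real j * \<gamma>) \<rho> (real j * (\<alpha> + \<beta>) + \<beta>) \<omega> f x) \<and>
      V (\<tau> x) = (\<Sum>i<n. c i * (\<psi> x - \<psi> a) ^ i
          * (\<Sum>j. lam ^ j * rpow (\<psi> x - \<psi> a) (real j * (\<alpha> + \<beta>))
              * mittag_leffler (real j * \<gamma>) \<rho> (real j * (\<alpha> + \<beta>) + real i + 1) (\<omega> * rpow (\<psi> x - \<psi> a) \<rho>)))
      + (\<Sum>j. lam ^ j * prabhakar_int a b \<psi> (real j * \<gamma>) \<rho> (real j * (\<alpha> + \<beta>) + \<beta>) \<omega> f x)"
    if x: "x \<in> {a..b}" for x
  proof -
    have X: "\<tau> x \<in> {0..T}" using \<tau>_mem[OF x] by (simp add: T_def)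
    \<comment> \<open>The factor \<open>\<tau> x ^ i\<close> has to be cancelled from the summability statement. At \<open>\<tau> x = 0\<close> this is impossible, but there only the term \<open>j = 0\<close> survives.\<close>
    define Q where "Q i = (\<lambda>j. lam ^ j * rpow (\<tau> x) (real j * \<delta>) *
      mittag_leffler (real j * \<gamma>) \<rho> (real j * \<delta> + real i + 1) (\<omega> * rpow (\<tau> x) \<rho>))" for i :: nat
    have WQ: "lam ^ j * W i j (\<tau> x) = \<tau> x ^ i * Q i j" for i j
      by (simp add: W_def Q_def monomial_resolvent_def mult_ac)
    have sumQ: "summable (Q i)" for i
    proof (cases "\<tau> x = 0")
      case True
      have "Q i j = 0" if "j \<notin> {0}" for j
        using that \<delta> True by (simp add: Q_def rpow_def)
      then show ?thesis by (intro summable_finite[of "{0}"]) auto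
    next
      case False
      then show ?thesis using W_summable[OF X, of i] by (simp add: WQ summable_cmult_iff)
    qed
    have "V (\<tau> x) = (\<Sum>i<n. c i * \<tau> x ^ i * (\<Sum>j. Q i j)) + (\<Sum>j. lam ^ j * F j (\<tau> x))"
      by (simp add: V_def WQ suminf_mult[OF sumQ] mult.assoc)
    then show ?thesis
      using sumQ F_summable[OF X] unfolding F_eq[OF x, unfolded \<delta>_def] Q_def \<delta>_def \<tau>_def
      by blast
  qed
  ultimately show ?thesis by auto
qed

end
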